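(* Let $\mathbf{A}_{m\times n}$ be a sequence of $m\times n$ real matrices, where $m$ and $n$ tend to infinity, whose entries are bounded in absolute value by a constant independent of $m$ and $n$. Assume that $\mathbf{A}_{m\times n}$ has exactly $k$ singular values of order greater than $\sqrt{m+n}$ ($k$ is fixed). If there are integers $a\ge k$ and $b\ge k$ (independent of $m,n$) such that the $a$-variance $S_a^2(\mathbf{Y})$ of the row-representatives and the $b$-variance $S_b^2(\mathbf{X})$ of the column-representatives are $\mathcal{O}\left(\frac{m+n}{mn}\right)$, then there is a blown up matrix $\mathbf{B}_{m\times n}$ such that $$\mathbf{A}_{m\times n}=\mathbf{B}_{m\times n}+\mathbf{E}_{m\times n},\qquad\text{with}\quad\|\mathbf{E}_{m\times n}\|=\mathcal{O}(\sqrt{m+n}).$$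
   Context: $\|\cdot\|$ is the spectral norm. "Exactly $k$ singular values of order greater than $\sqrt{m+n}$" means: the $k$ largest singular values $z_1,\dots,z_k$ satisfy $z_i/\sqrt{m+n}\to\infty$, while all the others are $\mathcal{O}(\sqrt{m+n})$ uniformly. Representatives: let $\mathbf{y}_1,\dots,\mathbf{y}_k\in\mathbb{R}^m$ and $\mathbf{x}_1,\dots,\mathbf{x}_k\in\mathbb{R}^n$ be orthonormal systems of left- and right-hand side singular vectors of $\mathbf{A}_{m\times n}$ corresponding to $z_1,\dots,z_k$ (with $\mathbf{A}\mathbf{x}_i=z_i\mathbf{y}_i$), $\mathbf{Y}=(\mathbf{y}_1,\dots,\mathbf{y}_k)$, $\mathbf{X}=(\mathbf{x}_1,\dots,\mathbf{x}_k)$. The row-representatives are the rows $\mathbf{y}^1,\dots,\mathbf{y}^m\in\mathbb{R}^k$ of $\mathbf{Y}$; the column-representatives are the rows $\mathbf{x}^1,\dots,\mathbf{x}^n\in\mathbb{R}^k$ of $\mathbf{X}$. The variances are $$S_a^2(\mathbf{Y})=\min_{\{A'_1,\dots,A'_a\}}\sum_{i=1}^a\sum_{j\in A'_i}\|\mathbf{y}^j-\bar{\mathbf{y}}^i\|^2,\quad \bar{\mathbf{y}}^i=\frac1{|A'_i|}\sum_{j\in A'_i}\mathbf{y}^j,$$ $$S_b^2(\mathbf{X})=\min_{\{B'_1,\dots,B'_b\}}\sum_{i=1}^b\sum_{j\in B'_i}\|\mathbf{x}^j-\bar{\mathbf{x}}^i\|^2,\quad \bar{\mathbf{x}}^i=\frac1{|B'_i|}\sum_{j\in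 B'_i}\mathbf{x}^j,$$ the minima being over all partitions of $\{1,\dots,m\}$ into $a$ parts and of $\{1,\dots,n\}$ into $b$ parts, respectively (in these formulas $\|\cdot\|$ is the Euclidean norm). Blown up matrix: an $m\times n$ real matrix $\mathbf{B}$ is a blown up matrix if there are an $a\times b$ pattern matrix $\mathbf{P}$ with non-negative entries $p_{ij}$ and positive integers $m_1,\dots,m_a$ with $\sum_{i=1}^a m_i=m$ and $n_1,\dots,n_b$ with $\sum_{j=1}^b n_j=n$, such that $\mathbf{B}$ can be divided into $a\times b$ blocks, where block $(i,j)$ is an $m_i\times n_j$ matrix with all entries equal to $p_{ij}$. Here the rows and columns of $\mathbf{A}_{m\times n}$ are understood to be reordered according to the clusters (the minimizing partitions in $S_a^2(\mathbf{Y})$ and $S_b^2(\mathbf{X})$).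
   Formalization: The pattern matrix of B may have real entries of any sign; non-negative entries are claimed only when A has non-negative entries. With non-negative patterns for all real A the claim fails, e.g. for A with all entries −1. *)

theory Defs
  imports
    "Jordan_Normal_Form.Char_Poly"
    "HOL-Library.Landau_Symbols"
    "HOL-Library.Disjoint_Sets"
    "HOL-Combinatorics.Permutations"
begin

definition vec_norm2 :: "real vec \<Rightarrow> real" where
  "vec_norm2 v = sqrt (v \<bullet> v)"

definition spectral_norm :: "real mat \<Rightarrow> real" where
  "spectral_norm A = Sup {vec_norm2 (A *\<^sub>v v) | v. v \<in> carrier_vec (dim_col A) \<and> vec_norm2 v \<le> 1}"

text \<open>
  All \<open>dim_col A\<close> of them, with multiplicity and in non-increasing order. If \<open>A\<close> has fewer rows than
  columns, this is the usual list of \<open>min (dim_row A) (dim_col A)\<close> singular values followed by zeros.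
\<close>
definition singular_values :: "real mat \<Rightarrow> real list" where
  "singular_values A =
     rev (sorted_list_of_multiset (image_mset sqrt (proots (char_poly (transpose_mat A * A)))))"

definition leading_singular_vectors :: "nat \<Rightarrow> real mat \<Rightarrow> real mat \<Rightarrow> real mat \<Rightarrow> bool" where
  "leading_singular_vectors k A Y X \<longleftrightarrow>
     Y \<in> carrier_mat (dim_row A) k \<and> X \<in> carrier_mat (dim_col A) k \<and>
     transpose_mat Y * Y = 1\<^sub>m k \<and> transpose_mat X * X = 1\<^sub>m k \<and>
     (\<forall>i<k. A *\<^sub>v col X i = (singular_values A ! i) \<cdot>\<^sub>v col Y i \<and>
            transpose_mat A *\<^sub>v col Y i = (singular_values A ! i) \<cdot>\<^sub>v col X i)"

definition cluster_mean :: "real mat \<Rightarrow> nat set \<Rightarrow> real vec" where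
  "cluster_mean Y C = vec (dim_col Y) (\<lambda>l. (\<Sum>j\<in>C. Y $$ (j, l)) / real (card C))"

definition clustering_cost :: "real mat \<Rightarrow> nat set set \<Rightarrow> real" where
  "clustering_cost Y \<C> = (\<Sum>C\<in>\<C>. \<Sum>j\<in>C. (vec_norm2 (row Y j - cluster_mean Y C))\<^sup>2)"

definition partitions_into :: "nat \<Rightarrow> nat \<Rightarrow> nat set set set" where
  "partitions_into a m = {\<C>. partition_on {..<m} \<C> \<and> card \<C> = a}"

text \<open>The \<open>a\<close>-variance of the rows of \<open>Y\<close>; meaningful only for \<open>1 \<le> a \<le> dim_row Y\<close>.\<close>
definition cluster_variance :: "nat \<Rightarrow> real mat \<Rightarrow> real" where
  "cluster_variance a Y = Min (clustering_cost Y ` partitions_into a (dim_row Y))"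

definition minimizing_partition :: "nat \<Rightarrow> real mat \<Rightarrow> nat set set \<Rightarrow> bool" where
  "minimizing_partition a Y \<C> \<longleftrightarrow>
     \<C> \<in> partitions_into a (dim_row Y) \<and> clustering_cost Y \<C> = cluster_variance a Y"

lemma finite_partitions_into: "finite (partitions_into a m)"
proof (rule finite_subset)
  show "partitions_into a m \<subseteq> Pow (Pow {..<m})"
    by (auto simp: partitions_into_def partition_on_def)
qed simp

lemma partitions_into_nonempty:
  assumes "1 \<le> a" "a \<le> m"
  shows "partitions_into a m \<noteq> {}"
proof -
  define g where "g x = (if x < a then x else 0)" for x :: nat
  define f where "f = (\<lambda>i. {x. x < m \<and> g x = i})"
  have f_iff: "x \<in> f i \<longleftrightarrow> x < m \<and> g x = i" for x i
    by (simp add: f_def)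
  have mem: "i \<in> f i" if "i < a" for i
    using that less_le_trans[OF that assms(2)] by (simp add: f_iff g_def)
  have eq: "i = j" if "x \<in> f i" "x \<in> f j" for x i j
    using that by (simp add: f_iff)
  have inj: "inj_on f {..<a}"
  proof (rule inj_onI)
    fix i j assume "i \<in> {..<a}" "f i = f j"
    then show "i = j" using mem[of i] eq[of i i j] by simp
  qed
  have "partition_on {..<m} (f ` {..<a})"
  proof (rule partition_onI)
    show "\<Union>(f ` {..<a}) = {..<m}"
    proof (intro equalityI subsetI)
      fix x assume "x \<in> {..<m}"
      then have "x \<in> f (g x)" by (simp add: f_iff)
      moreover have "g x \<in> {..<a}" using assms by (simp add: g_def)
      ultimately show "x \<in> \<Union>(f ` {..<a})" by blast
    qed (auto simp: f_iff)
  next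
    fix p q assume "p \<in> f ` {..<a}" "q \<in> f ` {..<a}" "p \<noteq> q"
    then show "disjnt p q" using eq unfolding disjnt_def by blast
  next
    show "{} \<notin> f ` {..<a}" using mem by blast
  qed
  moreover have "card (f ` {..<a}) = a" using card_image[OF inj] by simp
  ultimately show ?thesis unfolding partitions_into_def by blast
qed

lemma minimizing_partition_exists:
  assumes "1 \<le> a" "a \<le> dim_row Y"
  shows "\<exists>\<C>. minimizing_partition a Y \<C>"
proof -
  have "cluster_variance a Y \<in> clustering_cost Y ` partitions_into a (dim_row Y)"
    unfolding cluster_variance_def
    by (intro Min_in) (use assms in \<open>simp_all add: finite_partitions_into partitions_into_nonempty\<close>)
  then show ?thesis unfolding minimizing_partition_def by auto
qed

definition block_range :: "nat list \<Rightarrow> nat \<Rightarrow> nat set" where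
  "block_range ms i = {sum_list (take i ms) ..< sum_list (take (Suc i) ms)}"

text \<open>
  A blown up matrix with row block sizes \<open>ms\<close>, column block sizes \<open>ns\<close> and pattern matrix \<open>P\<close>.
  The sign of the entries of \<open>P\<close> is not part of this predicate: a matrix with negative entries, such as
  the one with all entries \<open>-1\<close>, need not be close to a blown up matrix with a non-negative pattern.
\<close>
definition blown_up_matrix :: "nat list \<Rightarrow> nat list \<Rightarrow> real mat \<Rightarrow> real mat \<Rightarrow> bool" where
  "blown_up_matrix ms ns P B \<longleftrightarrow>
     (\<forall>s\<in>set ms. 0 < s) \<and> (\<forall>s\<in>set ns. 0 < s) \<and>
     P \<in> carrier_mat (length ms) (length ns) \<and>
     B \<in> carrier_mat (sum_list ms) (sum_list ns) \<and>
     (\<forall>i<length ms. \<forall>j<length ns. \<forall>r\<in>block_range ms i. \<forall>s\<in>block_range ns j. B $$ (r, s) = P $$ (i, j))"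

definition nonneg_entries :: "real mat \<Rightarrow> bool" where
  "nonneg_entries A \<longleftrightarrow> (\<forall>i<dim_row A. \<forall>j<dim_col A. 0 \<le> A $$ (i, j))"

text \<open>
  Position \<open>r\<close> of the new order holds the old index \<open>\<pi> r\<close>; the clusters of \<open>\<C>\<close> occupy consecutive
  ranges of positions, of lengths \<open>ms\<close>.
\<close>
definition orders_by_clusters :: "nat \<Rightarrow> nat set set \<Rightarrow> (nat \<Rightarrow> nat) \<Rightarrow> nat list \<Rightarrow> bool" where
  "orders_by_clusters m \<C> \<pi> ms \<longleftrightarrow>
     \<pi> permutes {..<m} \<and>
     (\<exists>Cs. distinct Cs \<and> set Cs = \<C> \<and> ms = map card Cs \<and>
           (\<forall>i<length Cs. \<pi> ` block_range ms i = Cs ! i))"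

definition reorder_mat :: "(nat \<Rightarrow> nat) \<Rightarrow> (nat \<Rightarrow> nat) \<Rightarrow> real mat \<Rightarrow> real mat" where
  "reorder_mat \<pi> \<sigma> A = mat (dim_row A) (dim_col A) (\<lambda>(i, j). A $$ (\<pi> i, \<sigma> j))"

end

theory Submission
  imports Defs "HOL-Analysis.Function_Topology" "HOL-Analysis.L2_Norm"
begin

text \<open>
  Let \<open>p\<close> and \<open>q\<close> be the orthogonal projections onto the vectors that are constant on the row and
  column clusters. The blown up matrix is \<open>p A q\<close>, whose entries are the block averages of \<open>A\<close>.
  Write \<open>A = T + R\<close> with \<open>T = A X X\<^sup>T = Y Z X\<^sup>T\<close> the part belonging to the \<open>k\<close> leading singular
  values. Deflating the characteristic polynomial of \<open>A\<^sup>T A\<close> shows that the eigenvalues of \<open>R\<^sup>T R\<close> are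
  \<open>0\<close> and the squares of the remaining singular values, so \<open>R - p R q\<close> has norm of order
  \<open>sqrt (m + n)\<close>. Moreover \<open>T - p T q = (Y - p Y) Z X\<^sup>T + p A X (X - q X)\<^sup>T\<close>, the Frobenius norms of
  \<open>Y - p Y\<close> and \<open>X - q X\<close> are the square roots of the cluster variances, and the Frobenius norm of
  \<open>A\<close> is at most \<open>K sqrt (m n)\<close>.
\<close>

section \<open>Euclidean norm and the top eigenvalue of a Gram matrix\<close>

lemma scalar_prod_self_nonneg: "0 \<le> v \<bullet> (v :: real vec)"
  by (simp add: scalar_prod_def sum_nonneg)

lemma vec_norm2_nonneg [simp]: "0 \<le> vec_norm2 v"
  by (simp add: vec_norm2_def scalar_prod_self_nonneg)

lemma vec_norm2_square: "(vec_norm2 v)\<^sup>2 = v \<bullet> v"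
  by (simp add: vec_norm2_def scalar_prod_self_nonneg)

lemma vec_norm2_conv_L2_set:
  assumes "v \<in> carrier_vec n"
  shows "vec_norm2 v = L2_set (\<lambda>i. v $ i) {..<n}"
  using assms by (simp add: vec_norm2_def L2_set_def scalar_prod_def power2_eq_square atLeast0LessThan)

lemma vec_norm2_triangle:
  assumes "u \<in> carrier_vec n" "v \<in> carrier_vec n"
  shows "vec_norm2 (u + v) \<le> vec_norm2 u + vec_norm2 v"
proof -
  have "vec_norm2 (u + v) = L2_set (\<lambda>i. u $ i + v $ i) {..<n}"
    using assms by (subst vec_norm2_conv_L2_set[of _ n]) (auto intro: L2_set_cong)
  then show ?thesis
    using L2_set_triangle_ineq[of "\<lambda>i. u $ i" "\<lambda>i. v $ i" "{..<n}"] assms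
    by (simp add: vec_norm2_conv_L2_set[of _ n])
qed

lemma vec_norm2_triangle_minus:
  assumes "u \<in> carrier_vec n" "v \<in> carrier_vec n"
  shows "vec_norm2 (u - v) \<le> vec_norm2 u + vec_norm2 v"
proof -
  have "vec_norm2 (- v) = vec_norm2 v"
    using assms by (simp add: vec_norm2_def)
  moreover have "u - v = u + (- v)"
    using assms by auto
  ultimately show ?thesis
    using vec_norm2_triangle[of u n "- v"] assms by simp
qed

lemma scalar_prod_le_vec_norm2:
  assumes "u \<in> carrier_vec n" "v \<in> carrier_vec n"
  shows "u \<bullet> v \<le> vec_norm2 u * vec_norm2 v"
proof -
  have "u \<bullet> v \<le> (\<Sum>i<n. \<bar>u $ i\<bar> * \<bar>v $ i\<bar>)"
    using assms unfolding scalar_prod_def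
    by (auto simp: atLeast0LessThan abs_mult[symmetric] intro!: sum_mono)
  then show ?thesis
    using L2_set_mult_ineq[of "\<lambda>i. u $ i" "\<lambda>i. v $ i" "{..<n}"] assms
    by (simp add: vec_norm2_conv_L2_set[of _ n])
qed

section \<open>The Frobenius norm as a bound for the operator norm\<close>

definition frobenius_sq :: "real mat \<Rightarrow> real" where
  "frobenius_sq M = (\<Sum>i<dim_row M. \<Sum>j<dim_col M. (M $$ (i, j))\<^sup>2)"

lemma frobenius_sq_nonneg: "0 \<le> frobenius_sq M"
  by (simp add: frobenius_sq_def sum_nonneg)

lemma frobenius_sq_transpose: "frobenius_sq (transpose_mat M) = frobenius_sq M"
  unfolding frobenius_sq_def by (subst sum.swap) simp

text \<open>Cauchy-Schwarz in each row, followed by summation over the rows.\<close>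

lemma vec_norm2_mult_le_frobenius:
  assumes "v \<in> carrier_vec (dim_col M)"
  shows "vec_norm2 (M *\<^sub>v v) \<le> sqrt (frobenius_sq M) * vec_norm2 v"
proof -
  have "((M *\<^sub>v v) $ i)\<^sup>2 \<le> (\<Sum>j<dim_col M. (M $$ (i, j))\<^sup>2) * (v \<bullet> v)" if "i < dim_row M" for i
  proof -
    have "(row M i \<bullet> v)\<^sup>2 \<le> (row M i \<bullet> row M i) * (v \<bullet> v)"
    proof -
      \<comment> \<open>\<open>scalar_prod_le_vec_norm2\<close> is one-sided; applying it to the
        negated row as well bounds the absolute value.\<close>
      have "- (row M i \<bullet> v) = (- row M i) \<bullet> v" "vec_norm2 (- row M i) = vec_norm2 (row M i)"
        using assms by (simp_all add: vec_norm2_def)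
      then have "\<bar>row M i \<bullet> v\<bar> \<le> vec_norm2 (row M i) * vec_norm2 v"
        using scalar_prod_le_vec_norm2[of "row M i" "dim_col M" v]
          scalar_prod_le_vec_norm2[of "- row M i" "dim_col M" v] assms
        by (auto simp: abs_le_iff)
      then have "(row M i \<bullet> v)\<^sup>2 \<le> (vec_norm2 (row M i) * vec_norm2 v)\<^sup>2"
        by (metis abs_ge_zero power2_abs power_mono)
      then show ?thesis by (simp add: power_mult_distrib vec_norm2_square)
    qed
    moreover have "row M i \<bullet> row M i = (\<Sum>j<dim_col M. (M $$ (i, j))\<^sup>2)"
      using that by (simp add: scalar_prod_def power2_eq_square atLeast0LessThan)
    ultimately show ?thesis using that by simp
  qed
  then have "(\<Sum>i<dim_row M. ((M *\<^sub>v v) $ i)\<^sup>2) \<le> frobenius_sq M * (v \<bullet> v)"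
    unfolding frobenius_sq_def sum_distrib_right by (intro sum_mono) auto
  moreover have "(vec_norm2 (M *\<^sub>v v))\<^sup>2 = (\<Sum>i<dim_row M. ((M *\<^sub>v v) $ i)\<^sup>2)"
    unfolding vec_norm2_square by (simp add: scalar_prod_def power2_eq_square atLeast0LessThan)
  ultimately have "(vec_norm2 (M *\<^sub>v v))\<^sup>2 \<le> frobenius_sq M * (v \<bullet> v)"
    by simp
  then have "sqrt ((vec_norm2 (M *\<^sub>v v))\<^sup>2) \<le> sqrt (frobenius_sq M * (v \<bullet> v))"
    by (rule real_sqrt_le_mono)
  then show ?thesis by (simp add: real_sqrt_mult vec_norm2_def[of v])
qed

section \<open>The largest eigenvalue of a Gram matrix\<close>

lemma scalar_prod_mult_transpose:
  assumes "M \<in> carrier_mat r n" "u \<in> carrier_vec n" "v \<in> carrier_vec n"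
  shows "(M *\<^sub>v u) \<bullet> (M *\<^sub>v v) = ((transpose_mat M * M) *\<^sub>v u) \<bullet> (v :: real vec)"
  using assms transpose_vec_mult_scalar[of M r n v "M *\<^sub>v u"]
  by (simp add: assoc_mult_mat_vec[of _ n r _ n])

text \<open>A continuous quadratic form attains its maximum on the compact unit sphere. The sphere
  is modelled by functions on all natural numbers that vanish from index \<open>n\<close> on, under
  the product topology.\<close>

lemma vec_norm2_maximizer_exists:
  fixes M :: "real mat"
  assumes M: "M \<in> carrier_mat r n" and n: "0 < n"
  shows "\<exists>w \<mu>. w \<in> carrier_vec n \<and> w \<bullet> w = 1 \<and> (M *\<^sub>v w) \<bullet> (M *\<^sub>v w) = \<mu> \<and>
           (\<forall>v\<in>carrier_vec n. (M *\<^sub>v v) \<bullet> (M *\<^sub>v v) \<le> \<mu> * (v \<bullet> v))"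
proof -
  define q :: "(nat \<Rightarrow> real) \<Rightarrow> real" where "q v = (\<Sum>i<r. (\<Sum>j<n. M $$ (i, j) * v j)\<^sup>2)" for v
  have q: "(M *\<^sub>v v) \<bullet> (M *\<^sub>v v) = q (\<lambda>i. v $ i)" if "v \<in> carrier_vec n" for v
    using M that by (simp add: q_def scalar_prod_def power2_eq_square atLeast0LessThan)
  \<comment> \<open>A cube around the sphere; pinning the coordinates from \<open>n\<close> on to
    zero makes every factor compact, and hence the product.\<close>
  define B where "B = (PiE UNIV (\<lambda>i. if i < n then {-1..1::real} else {0}))"
  define S where "S = B \<inter> {v. (\<Sum>i<n. (v i)\<^sup>2) = 1}"
  have "compactin (product_topology (\<lambda>i. euclidean) UNIV) B"
    unfolding B_def by (subst compactin_PiE) auto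
  then have "compact B"
    by (simp add: euclidean_product_topology)
  have cont: "continuous_on UNIV (\<lambda>v :: nat \<Rightarrow> real. v i)" for i
    by (rule continuous_on_product_coordinates)
  have "closed {v :: nat \<Rightarrow> real. (\<Sum>i<n. (v i)\<^sup>2) = 1}"
    by (intro closed_Collect_eq continuous_intros cont)
  with \<open>compact B\<close> have "compact S"
    unfolding S_def by (rule compact_Int_closed)
  \<comment> \<open>The first unit vector shows that the sphere is nonempty, by
    \<open>0 < n\<close>.\<close>
  moreover have "(\<lambda>i. if i = 0 then 1 else 0) \<in> S"
    using n by (auto simp: S_def B_def if_distrib[of "\<lambda>x. x\<^sup>2"] cong: if_cong)
  then have "S \<noteq> {}" by blast
  moreover have "continuous_on S q"
    unfolding q_def by (rule continuous_on_subset[of UNIV]) (auto intro!: continuous_intros cont)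
  ultimately obtain w where w: "w \<in> S" and max: "\<And>v. v \<in> S \<Longrightarrow> q v \<le> q w"
    by (meson continuous_attains_sup)
  have "q (\<lambda>i. vec n w $ i) = q w"
    by (simp add: q_def)
  moreover have "vec n w \<bullet> vec n w = 1"
    using w by (simp add: S_def scalar_prod_def power2_eq_square atLeast0LessThan)
  moreover have "q (\<lambda>i. v $ i) \<le> q w * (v \<bullet> v)" if v: "v \<in> carrier_vec n" for v
  proof (cases "v \<bullet> v = 0")
    case True
    then have "(\<Sum>i<n. (v $ i)\<^sup>2) = 0"
      using v by (simp add: scalar_prod_def power2_eq_square atLeast0LessThan)
    then have "\<forall>i<n. v $ i = 0"
      by (subst (asm) sum_nonneg_eq_0_iff) auto
    then show ?thesis using True by (simp add: q_def)
  next
    case False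
    define s where "s = vec_norm2 v"
    have s: "s > 0" "s\<^sup>2 = v \<bullet> v"
      using False vec_norm2_nonneg[of v] vec_norm2_square[of v] by (auto simp: s_def less_le)
    \<comment> \<open>Normalising \<open>v\<close> puts it on the sphere. Since \<open>q\<close> is
      homogeneous of degree two, the maximum there scales to a bound for every
      \<open>v\<close>.\<close>
    define u where "u i = (if i < n then v $ i / s else 0)" for i
    have sum: "(\<Sum>i<n. (u i)\<^sup>2) = 1"
    proof -
      have "(\<Sum>i<n. (u i)\<^sup>2) = (\<Sum>i<n. (v $ i)\<^sup>2) / s\<^sup>2"
        by (simp add: u_def power_divide sum_divide_distrib)
      also have "(\<Sum>i<n. (v $ i)\<^sup>2) = s\<^sup>2"
        using v unfolding s(2) by (simp add: scalar_prod_def power2_eq_square atLeast0LessThan)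
      finally show ?thesis using s(1) by simp
    qed
    have u1: "\<bar>u i\<bar> \<le> 1" if "i < n" for i
    proof -
      have "(u i)\<^sup>2 \<le> (\<Sum>i<n. (u i)\<^sup>2)"
        using that by (intro member_le_sum) auto
      then show ?thesis using sum abs_square_le_1 by fastforce
    qed
    have "u i \<in> (if i < n then {-1..1} else {0})" for i
      using u1[of i] by (cases "i < n") (auto simp: abs_le_iff, simp add: u_def)
    then have "u \<in> S"
      using sum by (auto simp: S_def B_def)
    then have "q u \<le> q w" by (rule max)
    moreover have "q u = q (\<lambda>i. v $ i) / s\<^sup>2"
      by (simp add: q_def u_def sum_divide_distrib[symmetric] power_divide)
    ultimately show ?thesis
      using s(1) by (simp add: field_simps flip: s(2))
  qed
  ultimately show ?thesis
    using q by (intro exI[of _ "vec n w"] exI[of _ "q w"]) auto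
qed

text \<open>For small \<open>\<epsilon>\<close> of the sign of \<open>a\<close>, the linear term
  would outweigh the quadratic one.\<close>

lemma zero_if_linear_le_quadratic:
  fixes a c :: real
  assumes "\<And>\<epsilon>. 2 * \<epsilon> * a \<le> \<epsilon>\<^sup>2 * c"
  shows "a = 0"
proof (rule ccontr)
  assume "a \<noteq> 0"
  \<comment> \<open>With \<open>d\<close> positive and at least \<open>c\<close>, the choice
    \<open>\<epsilon> = a / d\<close> gives
    \<open>2 * a\<^sup>2 / d \<le> a\<^sup>2 / d\<close>.\<close>
  define d where "d = \<bar>c\<bar> + 1"
  have d: "d > 0" "c \<le> d" by (auto simp: d_def)
  have "2 * (a / d) * a \<le> (a / d)\<^sup>2 * c" by (rule assms)
  also have "\<dots> \<le> (a / d)\<^sup>2 * d" using d by (intro mult_left_mono) auto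
  finally have "2 * a\<^sup>2 / d \<le> a\<^sup>2 / d" using d by (simp add: power2_eq_square)
  then show False using d \<open>a \<noteq> 0\<close> by (simp add: divide_simps)
qed

text \<open>A variational argument: a unit maximizer \<open>w\<close> of the quadratic form is a
  critical point, and moving it along the defect \<open>p = H w - \<mu> w\<close> of the eigenvalue
  equation forces \<open>p = 0\<close>.\<close>

lemma gram_top_eigenvalue:
  fixes M :: "real mat"
  assumes M: "M \<in> carrier_mat r n" and n: "0 < n"
  shows "\<exists>\<mu>. eigenvalue (transpose_mat M * M) \<mu> \<and>
           (\<forall>v\<in>carrier_vec n. (vec_norm2 (M *\<^sub>v v))\<^sup>2 \<le> \<mu> * (vec_norm2 v)\<^sup>2)"
proof -
  obtain w \<mu> where w: "w \<in> carrier_vec n" "w \<bullet> w = 1"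
    and eq: "(M *\<^sub>v w) \<bullet> (M *\<^sub>v w) = \<mu>"
    and le: "\<And>v. v \<in> carrier_vec n \<Longrightarrow> (M *\<^sub>v v) \<bullet> (M *\<^sub>v v) \<le> \<mu> * (v \<bullet> v)"
    using vec_norm2_maximizer_exists[OF assms] by blast
  define H where "H = transpose_mat M * M"
  have H: "H \<in> carrier_mat n n" using M by (simp add: H_def)
  define p where "p = H *\<^sub>v w - \<mu> \<cdot>\<^sub>v w"
  have p: "p \<in> carrier_vec n" using H w by (simp add: p_def)
  note carr = w(1) p M
  \<comment> \<open>The first-order coefficient of the perturbation along \<open>p\<close> is
    exactly \<open>p \<bullet> p\<close>.\<close>
  have pp: "(M *\<^sub>v w) \<bullet> (M *\<^sub>v p) - \<mu> * (w \<bullet> p) = p \<bullet> p"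
  proof -
    have "(M *\<^sub>v w) \<bullet> (M *\<^sub>v p) = (H *\<^sub>v w) \<bullet> p"
      unfolding H_def by (rule scalar_prod_mult_transpose[OF M w(1) p])
    moreover have "p \<bullet> p = (H *\<^sub>v w) \<bullet> p - \<mu> * (w \<bullet> p)"
      by (subst (1) p_def) (use carr H in \<open>simp add: minus_scalar_prod_distrib[of _ n]\<close>)
    ultimately show ?thesis by simp
  qed
  \<comment> \<open>Maximality at \<open>w + e p\<close>, expanded in powers of \<open>e\<close>;
    the constant terms cancel because \<open>w\<close> attains the maximum.\<close>
  have "2 * e * (p \<bullet> p) \<le> e\<^sup>2 * (\<mu> * (p \<bullet> p) - (M *\<^sub>v p) \<bullet> (M *\<^sub>v p))" for e
  proof -
    have ep: "e \<cdot>\<^sub>v p \<in> carrier_vec n" using p by simp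
    have 1: "(w + e \<cdot>\<^sub>v p) \<bullet> (w + e \<cdot>\<^sub>v p) = 1 + 2 * e * (w \<bullet> p) + e\<^sup>2 * (p \<bullet> p)"
      using carr ep w(2) comm_scalar_prod[of p n w]
      by (simp add: add_scalar_prod_distrib[of _ n] scalar_prod_add_distrib[of _ n]
          power2_eq_square algebra_simps)
    have "M *\<^sub>v (w + e \<cdot>\<^sub>v p) = M *\<^sub>v w + e \<cdot>\<^sub>v (M *\<^sub>v p)"
      using carr ep by (simp add: mult_add_distrib_mat_vec[of _ r n] mult_mat_vec[of _ r n])
    then have 2: "(M *\<^sub>v (w + e \<cdot>\<^sub>v p)) \<bullet> (M *\<^sub>v (w + e \<cdot>\<^sub>v p)) =
        \<mu> + 2 * e * ((M *\<^sub>v w) \<bullet> (M *\<^sub>v p)) + e\<^sup>2 * ((M *\<^sub>v p) \<bullet> (M *\<^sub>v p))"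
      using carr eq comm_scalar_prod[of "M *\<^sub>v p" r "M *\<^sub>v w"]
      by (simp add: add_scalar_prod_distrib[of _ r] scalar_prod_add_distrib[of _ r]
          power2_eq_square algebra_simps)
    have "w + e \<cdot>\<^sub>v p \<in> carrier_vec n" using carr by simp
    from le[OF this] show ?thesis
      unfolding 1 2 pp[symmetric] by (simp add: algebra_simps)
  qed
  then have "p \<bullet> p = 0" by (rule zero_if_linear_le_quadratic)
  then have "p = 0\<^sub>v n"
    using conjugate_square_eq_0_vec[OF p] by simp
  then have "H *\<^sub>v w = \<mu> \<cdot>\<^sub>v w"
    using carr H by (auto simp: p_def vec_eq_iff)
  moreover have "w \<noteq> 0\<^sub>v n" using w by auto
  ultimately have "eigenvalue H \<mu>"
    using w H unfolding eigenvalue_def eigenvector_def by auto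
  then show ?thesis using le by (auto simp: H_def vec_norm2_square)
qed

section \<open>Determinants and singular values\<close>

text \<open>The Weinstein-Aronszajn identity. The block matrix with unit diagonal blocks and
  off-diagonal blocks \<open>U\<close> and \<open>V\<close> factors in two ways into block
  triangular matrices; comparing determinants gives both sides.\<close>

lemma det_one_minus_mult_commute:
  fixes U V :: "'a :: idom mat"
  assumes U: "U \<in> carrier_mat n k" and V: "V \<in> carrier_mat k n"
  shows "det (1\<^sub>m n - U * V) = det (1\<^sub>m k - V * U)"
proof -
  have carr: "1\<^sub>m n - U * V \<in> carrier_mat n n" "1\<^sub>m k - V * U \<in> carrier_mat k k"
    using U V by auto
  have 1: "four_block_mat (1\<^sub>m n) U (0\<^sub>m k n) (1\<^sub>m k) * four_block_mat (1\<^sub>m n - U * V) (0\<^sub>m n k) V (1\<^sub>m k)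
      = four_block_mat (1\<^sub>m n) U V (1\<^sub>m k)"
    by (subst mult_four_block_mat[of _ n n _ k _ k _ _ n _ k])
       (use U V carr in \<open>auto intro!: cong_four_block_mat eq_matI\<close>)
  have 2: "four_block_mat (1\<^sub>m n) (0\<^sub>m n k) V (1\<^sub>m k) * four_block_mat (1\<^sub>m n) U (0\<^sub>m k n) (1\<^sub>m k - V * U)
      = four_block_mat (1\<^sub>m n) U V (1\<^sub>m k)"
    by (subst mult_four_block_mat[of _ n n _ k _ k _ _ n _ k])
       (use U V carr in \<open>auto intro!: cong_four_block_mat eq_matI\<close>)
  have "det (four_block_mat (1\<^sub>m n) U (0\<^sub>m k n) (1\<^sub>m k) * four_block_mat (1\<^sub>m n - U * V) (0\<^sub>m n k) V (1\<^sub>m k))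
      = det (1\<^sub>m n - U * V)"
    using U V carr
    by (subst det_mult[of _ "n + k"])
       (auto simp: det_four_block_mat_lower_left_zero[of _ n _ k] det_four_block_mat_upper_right_zero[of _ n _ k])
  moreover have "det (four_block_mat (1\<^sub>m n) (0\<^sub>m n k) V (1\<^sub>m k) * four_block_mat (1\<^sub>m n) U (0\<^sub>m k n) (1\<^sub>m k - V * U))
      = det (1\<^sub>m k - V * U)"
    using U V carr
    by (subst det_mult[of _ "n + k"])
       (auto simp: det_four_block_mat_lower_left_zero[of _ n _ k] det_four_block_mat_upper_right_zero[of _ n _ k])
  ultimately show ?thesis unfolding 1 2 by simp
qed

section \<open>Diagonal matrices and deflation of the characteristic polynomial\<close>

definition diagonal_mat_of :: "nat \<Rightarrow> (nat \<Rightarrow> 'a) \<Rightarrow> 'a :: zero mat" where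
  "diagonal_mat_of k d = mat k k (\<lambda>(i, j). if i = j then d i else 0)"

lemma diagonal_mat_of_carrier [simp]: "diagonal_mat_of k d \<in> carrier_mat k k"
  by (simp add: diagonal_mat_of_def)

lemma dim_diagonal_mat_of [simp]:
  "dim_row (diagonal_mat_of k d) = k" "dim_col (diagonal_mat_of k d) = k"
  by (simp_all add: diagonal_mat_of_def)

lemma col_mult_diagonal_mat_of:
  fixes X :: "'a :: comm_semiring_0 mat"
  assumes "X \<in> carrier_mat n k" "j < k"
  shows "col (X * diagonal_mat_of k d) j = d j \<cdot>\<^sub>v col X j"
proof (rule eq_vecI)
  fix i assume "i < dim_vec (d j \<cdot>\<^sub>v col X j)"
  then have i: "i < n" using assms by simp
  have "(\<Sum>l = 0..<k. X $$ (i, l) * (if l = j then d l else 0)) = (\<Sum>l = 0..<k. if l = j then X $$ (i, l) * d l else 0)"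
    by (intro sum.cong) auto
  then show "col (X * diagonal_mat_of k d) j $ i = (d j \<cdot>\<^sub>v col X j) $ i"
    using assms i by (simp add: diagonal_mat_of_def scalar_prod_def mult.commute)
qed (use assms in \<open>simp_all\<close>)

lemma det_one_minus_diagonal_mat_of:
  "det (1\<^sub>m k - diagonal_mat_of k d) = (\<Prod>i<k. 1 - (d i :: 'a :: comm_ring_1))"
proof -
  have "det (1\<^sub>m k - diagonal_mat_of k d) = prod_list (diag_mat (1\<^sub>m k - diagonal_mat_of k d))"
    by (rule det_upper_triangular[of _ k]) (auto simp: diagonal_mat_of_def upper_triangular_def)
  also have "\<dots> = (\<Prod>i<k. 1 - d i)"
    by (auto simp: prod_list_diag_prod diagonal_mat_of_def atLeast0LessThan intro!: prod.cong)
  finally show ?thesis .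
qed

lemma poly_char_poly_eq_det:
  fixes S :: "'a :: field mat"
  assumes "S \<in> carrier_mat n n"
  shows "poly (char_poly S) t = det (t \<cdot>\<^sub>m 1\<^sub>m n - S)"
  unfolding char_poly_matrix[OF assms]
  by (rule arg_cong[of _ _ det], rule eq_matI) (use assms in \<open>auto simp: char_matrix_def\<close>)

text \<open>
  Since \<open>(S - X D X\<^sup>T) X = 0\<close>, the matrix \<open>t - S\<close> factors as
  \<open>(t - (S - X D X\<^sup>T)) (1 - X D X\<^sup>T / t)\<close> for every \<open>t \<noteq> 0\<close>.
\<close>
lemma char_poly_deflate:
  fixes S X :: "real mat"
  assumes S: "S \<in> carrier_mat n n" and X: "X \<in> carrier_mat n k"
    and XX: "transpose_mat X * X = 1\<^sub>m k" and SX: "S * X = X * diagonal_mat_of k d"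
  shows "[:0, 1:] ^ k * char_poly S =
    char_poly (S - X * diagonal_mat_of k d * transpose_mat X) * (\<Prod>i<k. [:- d i, 1:])"
proof -
  define D where "D = diagonal_mat_of k d"
  define Q where "Q = X * D * transpose_mat X"
  define G where "G = S - Q"
  have D: "D \<in> carrier_mat k k" by (simp add: D_def)
  have XT: "transpose_mat X \<in> carrier_mat k n" using X by simp
  have XD: "X * D \<in> carrier_mat n k" using X D by simp
  have Q: "Q \<in> carrier_mat n n" using X D by (simp add: Q_def)
  have G: "G \<in> carrier_mat n n" unfolding G_def by (rule minus_carrier_mat[OF Q])
  \<comment> \<open>Both \<open>S * Q\<close> and \<open>Q * Q\<close> equal
    \<open>X D D X\<^sup>T\<close>, so \<open>G * Q\<close> vanishes; this removes the cross term
    from the factorization of \<open>t - S\<close>.\<close>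
  have "S * Q = X * D * D * transpose_mat X"
    unfolding Q_def assoc_mult_mat[OF X D XT] using S X D XT SX
    by (simp add: D_def[symmetric] assoc_mult_mat[of _ n n _ k _ n, symmetric]
        assoc_mult_mat[of _ n k _ k _ n])
  moreover have "Q * Q = X * D * D * transpose_mat X"
  proof -
    have "Q * Q = X * D * (transpose_mat X * (X * D * transpose_mat X))"
      unfolding Q_def by (rule assoc_mult_mat) (use X D in auto)
    also have "transpose_mat X * (X * D * transpose_mat X) = D * transpose_mat X"
      using X D XT XX
      by (simp add: assoc_mult_mat[of _ n k _ k _ n] assoc_mult_mat[of _ k n _ k _ n, symmetric])
    finally show ?thesis using XD D XT by (simp add: assoc_mult_mat[of _ n k _ k _ n])
  qed
  ultimately have "S * Q = Q * Q" by simp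
  then have GQ: "G * Q = 0\<^sub>m n n"
    using minus_mult_distrib_mat[OF S Q Q] minus_r_inv_mat[of "Q * Q" n n] Q by (simp add: G_def)
  have pointwise: "poly ([:0, 1:] ^ k * char_poly S) t = poly (char_poly G * (\<Prod>i<k. [:- d i, 1:])) t"
    if t: "t \<noteq> 0" for t
  proof -
    have tG: "t \<cdot>\<^sub>m 1\<^sub>m n - G \<in> carrier_mat n n" by (rule minus_carrier_mat[OF G])
    have cQ: "(1 / t) \<cdot>\<^sub>m Q \<in> carrier_mat n n" using Q by simp
    have "(t \<cdot>\<^sub>m 1\<^sub>m n - G) * Q = t \<cdot>\<^sub>m Q"
      using minus_mult_distrib_mat[of "t \<cdot>\<^sub>m 1\<^sub>m n" n n G Q] Q G by (auto simp: GQ intro!: eq_matI)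
    then have tGQ: "(t \<cdot>\<^sub>m 1\<^sub>m n - G) * ((1 / t) \<cdot>\<^sub>m Q) = Q"
      using mult_smult_distrib[OF tG Q, of "1 / t"] t by (auto intro!: eq_matI)
    have "(t \<cdot>\<^sub>m 1\<^sub>m n - G) * (1\<^sub>m n - (1 / t) \<cdot>\<^sub>m Q) = (t \<cdot>\<^sub>m 1\<^sub>m n - G) - Q"
      using mult_minus_distrib_mat[OF tG one_carrier_mat cQ] right_mult_one_mat[OF tG] by (simp add: tGQ)
    also have "\<dots> = t \<cdot>\<^sub>m 1\<^sub>m n - S"
      using S Q by (auto simp: G_def)
    finally have "det (t \<cdot>\<^sub>m 1\<^sub>m n - S) = det (t \<cdot>\<^sub>m 1\<^sub>m n - G) * det (1\<^sub>m n - (1 / t) \<cdot>\<^sub>m Q)"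
      using det_mult[OF tG minus_carrier_mat[OF cQ, of "1\<^sub>m n"]] by simp
    \<comment> \<open>The commutation identity reduces the determinant to size \<open>k\<close>,
      where \<open>X\<^sup>T X = 1\<close> leaves a diagonal matrix.\<close>
    also have "det (1\<^sub>m n - (1 / t) \<cdot>\<^sub>m Q) = (\<Prod>i<k. 1 - d i / t)"
    proof -
      have "(1 / t) \<cdot>\<^sub>m Q = ((1 / t) \<cdot>\<^sub>m (X * D)) * transpose_mat X"
        unfolding Q_def by (rule mult_smult_assoc_mat[OF XD XT, symmetric])
      moreover have "transpose_mat X * ((1 / t) \<cdot>\<^sub>m (X * D)) = diagonal_mat_of k (\<lambda>i. d i / t)"
      proof -
        have "transpose_mat X * ((1 / t) \<cdot>\<^sub>m (X * D)) = (1 / t) \<cdot>\<^sub>m (transpose_mat X * X * D)"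
          unfolding mult_smult_distrib[OF XT XD] assoc_mult_mat[OF XT X D] ..
        also have "\<dots> = diagonal_mat_of k (\<lambda>i. d i / t)"
          unfolding XX using D by (auto simp: D_def diagonal_mat_of_def)
        finally show ?thesis .
      qed
      ultimately show ?thesis
        using det_one_minus_mult_commute[of "(1 / t) \<cdot>\<^sub>m (X * D)" n k "transpose_mat X"] XD XT
        by (simp add: det_one_minus_diagonal_mat_of)
    qed
    \<comment> \<open>The factor \<open>t ^ k\<close> supplies one \<open>t\<close> to each of the
      \<open>k\<close> factors and clears their denominators.\<close>
    finally have "t ^ k * det (t \<cdot>\<^sub>m 1\<^sub>m n - S) = det (t \<cdot>\<^sub>m 1\<^sub>m n - G) * (\<Prod>i<k. t * (1 - d i / t))"
      by (simp add: prod.distrib)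
    also have "(\<Prod>i<k. t * (1 - d i / t)) = (\<Prod>i<k. t - d i)"
      using t by (intro prod.cong) (auto simp: field_simps)
    finally show ?thesis
      using S G by (simp add: poly_char_poly_eq_det poly_prod)
  qed
  \<comment> \<open>The pointwise identity excludes \<open>t = 0\<close>. An extra factor of the
    variable makes both sides vanish there, so they agree as polynomials, and the factor is then
    cancelled.\<close>
  have "[:0, 1:] * ([:0, 1:] ^ k * char_poly S) = [:0, 1:] * (char_poly G * (\<Prod>i<k. [:- d i, 1:]))"
    unfolding poly_eq_poly_eq_iff[symmetric]
  proof
    fix t show "poly ([:0, 1:] * ([:0, 1:] ^ k * char_poly S)) t = poly ([:0, 1:] * (char_poly G * (\<Prod>i<k. [:- d i, 1:]))) t"
      using pointwise[of t] by (cases "t = 0") simp_all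
  qed
  then show ?thesis unfolding G_def Q_def D_def by (subst (asm) mult_cancel_left) simp
qed

section \<open>Singular values and the residual after removing the leading part\<close>

lemma mset_singular_values:
  "mset (singular_values A) = image_mset sqrt (proots (char_poly (transpose_mat A * A)))"
  by (simp add: singular_values_def)

text \<open>Roots of a product of linear factors arise as a sum of singletons; this turns the sum
  into an initial segment of the list.\<close>

lemma sum_singleton_mset_nth:
  "k \<le> length xs \<Longrightarrow> (\<Sum>i<k. {#xs ! i#}) = mset (take k xs)"
  by (induction k) (auto simp: take_Suc_conv_app_nth)

text \<open>The singular vector equations in matrix form, checked column by column.\<close>

lemma eigen_equations_of_leading:
  assumes A: "A \<in> carrier_mat m n" and lead: "leading_singular_vectors k A Y X"
  defines "Z \<equiv> diagonal_mat_of k (\<lambda>i. singular_values A ! i)"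
  shows "A * X = Y * Z" "transpose_mat A * Y = X * Z"
proof -
  have Y: "Y \<in> carrier_mat m k" and X: "X \<in> carrier_mat n k"
    and eq: "\<And>i. i < k \<Longrightarrow> A *\<^sub>v col X i = (singular_values A ! i) \<cdot>\<^sub>v col Y i"
       "\<And>i. i < k \<Longrightarrow> transpose_mat A *\<^sub>v col Y i = (singular_values A ! i) \<cdot>\<^sub>v col X i"
    using lead A by (auto simp: leading_singular_vectors_def)
  have Z: "Z \<in> carrier_mat k k" by (simp add: Z_def)
  show "A * X = Y * Z"
  proof (rule mat_col_eqI)
    fix i assume "i < dim_col (Y * Z)"
    then have i: "i < k" using Z by simp
    show "col (A * X) i = col (Y * Z) i"
      unfolding col_mult2[OF A X i] Z_def col_mult_diagonal_mat_of[OF Y i] by (rule eq(1)[OF i])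
  qed (use A X Y Z in simp_all)
  show "transpose_mat A * Y = X * Z"
  proof (rule mat_col_eqI)
    fix i assume "i < dim_col (X * Z)"
    then have i: "i < k" using Z by simp
    have "transpose_mat A \<in> carrier_mat n m" using A by simp
    then show "col (transpose_mat A * Y) i = col (X * Z) i"
      unfolding col_mult2[OF _ Y i] Z_def col_mult_diagonal_mat_of[OF X i]
      by (simp only: col_mult2[OF _ Y i] eq(2)[OF i])
  qed (use A X Y Z in simp_all)
qed

text \<open>With \<open>S = A\<^sup>T A\<close>, the residual \<open>R = A - A X X\<^sup>T\<close>
  satisfies \<open>R\<^sup>T R = S - X D X\<^sup>T\<close>. Deflation identifies the eigenvalues of
  this matrix as \<open>k\<close> zeros together with the squares of the remaining singular values,
  so its top eigenvalue is at most \<open>c\<^sup>2\<close>.\<close>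

lemma residual_norm_le:
  assumes A: "A \<in> carrier_mat m n" and lead: "leading_singular_vectors k A Y X"
    and len: "k \<le> length (singular_values A)"
    and nonneg: "\<And>i. i < k \<Longrightarrow> 0 \<le> singular_values A ! i"
    and le: "\<And>i. k \<le> i \<Longrightarrow> i < length (singular_values A) \<Longrightarrow> singular_values A ! i \<le> c"
    and c: "0 \<le> c" and v: "v \<in> carrier_vec n"
  shows "vec_norm2 ((A - A * X * transpose_mat X) *\<^sub>v v) \<le> c * vec_norm2 v"
proof (cases "n = 0")
  \<comment> \<open>Without columns there is no eigenvalue to work with, but then \<open>v\<close>
    has norm zero.\<close>
  case True
  have "vec_norm2 ((A - A * X * transpose_mat X) *\<^sub>v v) \<le>
      sqrt (frobenius_sq (A - A * X * transpose_mat X)) * vec_norm2 v"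
    by (rule vec_norm2_mult_le_frobenius) (use A v lead in \<open>auto simp: leading_singular_vectors_def\<close>)
  moreover have "vec_norm2 v = 0"
    using v True by (simp add: vec_norm2_def scalar_prod_def)
  ultimately show ?thesis by simp
next
  case False
  define sv where "sv = singular_values A"
  define S where "S = transpose_mat A * A"
  define R where "R = A - A * X * transpose_mat X"
  define D where "D = diagonal_mat_of k (\<lambda>i. (sv ! i)\<^sup>2)"
  define Z where "Z = diagonal_mat_of k (\<lambda>i. sv ! i)"
  have Y: "Y \<in> carrier_mat m k" and X: "X \<in> carrier_mat n k"
    and XX: "transpose_mat X * X = 1\<^sub>m k"
    using lead A by (auto simp: leading_singular_vectors_def)
  have S: "S \<in> carrier_mat n n" using A by (simp add: S_def)
  have D: "D \<in> carrier_mat k k" and Z: "Z \<in> carrier_mat k k" by (simp_all add: D_def Z_def)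
  have XT: "transpose_mat X \<in> carrier_mat k n" and AT: "transpose_mat A \<in> carrier_mat n m"
    using X A by simp_all
  have ZZ: "Z * Z = D"
  proof (rule mat_col_eqI)
    fix i assume "i < dim_col D"
    then have "i < k" using D by simp
    then show "col (Z * Z) i = col D i"
      by (subst (2) Z_def, subst col_mult_diagonal_mat_of[OF Z])
         (auto simp: Z_def D_def diagonal_mat_of_def power2_eq_square)
  qed (simp_all add: Z_def D_def)
  have DT: "transpose_mat D = D" by (auto simp: D_def diagonal_mat_of_def)
  have ST: "transpose_mat S = S" using A by (simp add: S_def transpose_mult[of _ n m])
  have SX: "S * X = X * D"
  proof -
    have "S * X = transpose_mat A * (A * X)"
      unfolding S_def by (rule assoc_mult_mat) (use A X in auto)
    also have "A * X = Y * Z" unfolding Z_def sv_def by (rule eigen_equations_of_leading[OF A lead])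
    also have "transpose_mat A * (Y * Z) = transpose_mat A * Y * Z"
      by (rule assoc_mult_mat[symmetric]) (use A Y Z in auto)
    also have "transpose_mat A * Y = X * Z" unfolding Z_def sv_def by (rule eigen_equations_of_leading[OF A lead])
    also have "X * Z * Z = X * D" unfolding ZZ[symmetric] by (rule assoc_mult_mat) (use X Z in auto)
    finally show ?thesis .
  qed
  \<comment> \<open>The transpose of \<open>S X = X D\<close>, with \<open>S\<close> and
    \<open>D\<close> symmetric.\<close>
  have XS: "transpose_mat X * S = D * transpose_mat X"
    using arg_cong[OF SX, of transpose_mat] S X D
    by (simp add: transpose_mult[of _ n n] transpose_mult[of _ n k] ST DT)
  have R: "R \<in> carrier_mat m n" 
    unfolding R_def by (rule minus_carrier_mat) (use A X in auto)
  have RT: "transpose_mat R = transpose_mat A - X * (transpose_mat X * transpose_mat A)"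
  proof -
    have AX: "A * X \<in> carrier_mat m k" using A X by simp
    have "transpose_mat (A * X * transpose_mat X) = X * (transpose_mat X * transpose_mat A)"
      unfolding transpose_mult[OF AX XT] transpose_mult[OF A X] by simp
    then show ?thesis
      unfolding R_def using transpose_minus[OF A, of "A * X * transpose_mat X"] AX XT by simp
  qed
  have RTA: "transpose_mat R * A = S - X * D * transpose_mat X"
  proof -
    have "transpose_mat R * A = S - X * (transpose_mat X * transpose_mat A) * A"
      unfolding RT S_def by (rule minus_mult_distrib_mat) (use A X in auto)
    also have "X * (transpose_mat X * transpose_mat A) * A = X * (transpose_mat X * transpose_mat A * A)"
      by (rule assoc_mult_mat) (use A X in auto)
    also have "transpose_mat X * transpose_mat A * A = transpose_mat X * S"
      unfolding S_def by (rule assoc_mult_mat) (use A X in auto)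
    also have "X * (transpose_mat X * S) = X * D * transpose_mat X"
      unfolding XS by (rule assoc_mult_mat[symmetric]) (use D X in auto)
    finally show ?thesis .
  qed
  \<comment> \<open>The deflated matrix annihilates \<open>X\<close>. This makes
    \<open>R\<^sup>T R\<close> collapse to \<open>R\<^sup>T A\<close>.\<close>
  have "transpose_mat R * A * X = 0\<^sub>m n k"
  proof -
    have "transpose_mat R * A * X = S * X - X * D * transpose_mat X * X"
      unfolding RTA by (rule minus_mult_distrib_mat) (use S D X in auto)
    also have "X * D * transpose_mat X * X = X * D * (transpose_mat X * X)"
      by (rule assoc_mult_mat) (use D X in auto)
    finally show ?thesis using X D by (simp add: XX SX)
  qed
  moreover have "transpose_mat R * R = transpose_mat R * A - transpose_mat R * A * X * transpose_mat X"
  proof -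
    have "transpose_mat R * R = transpose_mat R * A - transpose_mat R * (A * X * transpose_mat X)"
      by (subst (2) R_def, rule mult_minus_distrib_mat) (use R A X in auto)
    also have "transpose_mat R * (A * X * transpose_mat X) = transpose_mat R * (A * X) * transpose_mat X"
      by (rule assoc_mult_mat[symmetric]) (use R A X in auto)
    also have "transpose_mat R * (A * X) = transpose_mat R * A * X"
      by (rule assoc_mult_mat[symmetric]) (use R A X in auto)
    finally show ?thesis .
  qed
  moreover have G: "S - X * D * transpose_mat X \<in> carrier_mat n n"
    by (rule minus_carrier_mat[OF mult_carrier_mat[OF mult_carrier_mat[OF X D] XT]])
  moreover have minus_zero: "M - 0\<^sub>m n n = M" if "M \<in> carrier_mat n n" for M :: "real mat"
    using that by (auto intro!: eq_matI)
  ultimately have RR: "transpose_mat R * R = S - X * D * transpose_mat X"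
    using XT minus_zero[OF G] by (simp add: RTA del: assoc_mult_mat)
  obtain \<mu> where ev: "eigenvalue (transpose_mat R * R) \<mu>"
    and max: "\<And>v. v \<in> carrier_vec n \<Longrightarrow> (vec_norm2 (R *\<^sub>v v))\<^sup>2 \<le> \<mu> * (vec_norm2 v)\<^sup>2"
    using gram_top_eigenvalue[OF R] False by blast
  let ?G = "S - X * D * transpose_mat X"
  have monic: "char_poly M \<noteq> 0" if "M \<in> carrier_mat n n" for M :: "real mat"
    using degree_monic_char_poly[OF that] by auto
  have prod0: "(\<Prod>i<k. [:- (sv ! i)\<^sup>2, 1:]) \<noteq> (0 :: real poly)" by simp
  have "proots ([:0, 1:] ^ k * char_poly S) = proots (char_poly ?G * (\<Prod>i<k. [:- (sv ! i)\<^sup>2, 1:]))"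
    using char_poly_deflate[OF S X XX SX[unfolded D_def]] by (simp add: D_def)
  \<comment> \<open>The deflation identity read as an equality of root multisets: the factor
    \<open>[:0, 1:] ^ k\<close> contributes the zeros, the linear factors the squared leading
    values.\<close>
  then have "repeat_mset k {#0#} + proots (char_poly S) = proots (char_poly ?G) + (\<Sum>i<k. {#(sv ! i)\<^sup>2#})"
    using monic[OF S] monic[OF G] prod0
    by (simp add: proots_mult proots_power proots_prod)
  then have "image_mset sqrt (repeat_mset k {#0#}) + mset sv =
      image_mset sqrt (proots (char_poly ?G)) + image_mset sqrt (\<Sum>i<k. {#(sv ! i)\<^sup>2#})"
    unfolding sv_def mset_singular_values S_def[symmetric] by (metis image_mset_union)
  \<comment> \<open>Nonnegativity of the leading values lets \<open>sqrt\<close> undo the squares,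
    so that they cancel against the first \<open>k\<close> entries of \<open>sv\<close>.\<close>
  moreover have "image_mset sqrt (\<Sum>i<k. {#(sv ! i)\<^sup>2#}) = (\<Sum>i<k. {#sv ! i#})"
  proof -
    have "image_mset sqrt (\<Sum>i<j. {#(sv ! i)\<^sup>2#}) = (\<Sum>i<j. {#sv ! i#})" if "j \<le> k" for j
      using that by (induction j) (auto simp: nonneg sv_def)
    then show ?thesis by simp
  qed
  moreover have "mset sv = mset (drop k sv) + mset (take k sv)"
    by (metis append_take_drop_id mset_append union_commute)
  ultimately have "image_mset sqrt (proots (char_poly ?G)) = image_mset sqrt (repeat_mset k {#0#}) + mset (drop k sv)"
    using len by (simp add: sum_singleton_mset_nth sv_def)
  moreover have "\<mu> \<in># proots (char_poly ?G)"
    using ev monic[OF G] unfolding RR eigenvalue_root_char_poly[OF G] by simp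
  ultimately have "sqrt \<mu> \<in># image_mset sqrt (repeat_mset k {#0#}) + mset (drop k sv)"
    by (metis image_eqI set_image_mset)
  then have "sqrt \<mu> = 0 \<or> sqrt \<mu> \<in> set (drop k sv)"
    by (auto split: if_splits)
  then have "sqrt \<mu> \<le> c"
  proof
    assume "sqrt \<mu> \<in> set (drop k sv)"
    then obtain i where "i < length sv - k" "sqrt \<mu> = sv ! (k + i)"
      by (auto simp: in_set_conv_nth)
    then show ?thesis using le[of "k + i"] by (simp add: sv_def)
  qed (use c in simp)
  \<comment> \<open>\<open>sqrt\<close> is increasing on all reals, so the bound passes to
    \<open>\<mu>\<close> whatever its sign.\<close>
  then have "\<mu> \<le> c\<^sup>2"
    using c by (metis real_sqrt_abs abs_of_nonneg real_sqrt_le_iff)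
  then have "(vec_norm2 (R *\<^sub>v v))\<^sup>2 \<le> (c * vec_norm2 v)\<^sup>2"
    using max[OF v] by (simp add: power_mult_distrib) (meson mult_right_mono order_trans zero_le_power2)
  then show ?thesis
    unfolding R_def using c by (simp add: power2_le_iff_abs_le)
qed

section \<open>Averaging over clusters\<close>

text \<open>For a partition this is the orthogonal projection onto the vectors constant on each
  cluster. At most one summand is then nonzero; the sum avoids having to name the cluster of an
  index.\<close>

definition averaging_mat :: "nat \<Rightarrow> nat set set \<Rightarrow> real mat" where
  "averaging_mat m \<C> =
     mat m m (\<lambda>(i, j). \<Sum>C\<in>\<C>. if i \<in> C \<and> j \<in> C then 1 / real (card C) else 0)"

lemma averaging_mat_carrier [simp]: "averaging_mat m \<C> \<in> carrier_mat m m"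
  by (simp add: averaging_mat_def)

lemma dim_averaging_mat [simp]:
  "dim_row (averaging_mat m \<C>) = m" "dim_col (averaging_mat m \<C>) = m"
  by (simp_all add: averaging_mat_def)

lemma averaging_mat_transpose: "transpose_mat (averaging_mat m \<C>) = averaging_mat m \<C>"
  by (rule eq_matI) (auto simp: averaging_mat_def conj_commute)

lemma averaging_mat_nonneg: "i < m \<Longrightarrow> j < m \<Longrightarrow> 0 \<le> averaging_mat m \<C> $$ (i, j)"
  by (auto simp: averaging_mat_def intro!: sum_nonneg)

lemma partition_on_lessThan:
  assumes "partition_on {..<m :: nat} \<C>"
  shows "finite \<C>" and "C \<in> \<C> \<Longrightarrow> C \<subseteq> {..<m}" and "C \<in> \<C> \<Longrightarrow> finite C"
    and "C \<in> \<C> \<Longrightarrow> 0 < card C" and "i < m \<Longrightarrow> \<exists>C\<in>\<C>. i \<in> C"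
    and "C \<in> \<C> \<Longrightarrow> C' \<in> \<C> \<Longrightarrow> i \<in> C \<Longrightarrow> i \<in> C' \<Longrightarrow> C = C'"
proof -
  show "finite \<C>" using assms by (rule finite_elements[OF finite_lessThan])
  show sub: "C \<subseteq> {..<m}" if "C \<in> \<C>" for C
    using assms that by (auto simp: partition_on_def)
  then show fin: "finite C" if "C \<in> \<C>" for C
    using that finite_subset by blast
  show "0 < card C" if "C \<in> \<C>"
    using assms that fin by (auto simp: partition_on_def card_gt_0_iff)
  show "\<exists>C\<in>\<C>. i \<in> C" if "i < m"
    using assms that by (auto simp: partition_on_def)
  show "C = C'" if "C \<in> \<C>" "C' \<in> \<C>" "i \<in> C" "i \<in> C'"
    using assms that by (auto simp: partition_on_def disjoint_def)
qed

lemma averaging_mat_entry: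
  assumes part: "partition_on {..<m} \<C>" and C: "C \<in> \<C>" "i \<in> C" and j: "j < m"
  shows "averaging_mat m \<C> $$ (i, j) = (if j \<in> C then 1 / real (card C) else 0)"
proof -
  note P = partition_on_lessThan[OF part]
  have "i < m" using P(2) C by auto
  then have "averaging_mat m \<C> $$ (i, j) = (\<Sum>C\<in>\<C>. if i \<in> C \<and> j \<in> C then 1 / real (card C) else 0)"
    using j by (simp add: averaging_mat_def)
  also have "\<dots> = (\<Sum>C'\<in>\<C>. if C' = C then (if j \<in> C then 1 / real (card C) else 0) else 0)"
    using C P(6) by (intro sum.cong) auto
  also have "\<dots> = (if j \<in> C then 1 / real (card C) else 0)"
    using P(1) C by simp
  finally show ?thesis .
qed

text \<open>Links the projection to cluster means: this quotient is an entry of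
  \<open>cluster_mean M C\<close>.\<close>

lemma averaging_mat_mult:
  assumes part: "partition_on {..<m} \<C>" and C: "C \<in> \<C>" "i \<in> C"
    and M: "M \<in> carrier_mat m c" and l: "l < c"
  shows "(averaging_mat m \<C> * M) $$ (i, l) = (\<Sum>j\<in>C. M $$ (j, l)) / real (card C)"
proof -
  note P = partition_on_lessThan[OF part]
  have i: "i < m" using P(2) C by auto
  have "(averaging_mat m \<C> * M) $$ (i, l) = (\<Sum>j<m. averaging_mat m \<C> $$ (i, j) * M $$ (j, l))"
    using i l M by (simp add: scalar_prod_def averaging_mat_def atLeast0LessThan)
  also have "\<dots> = (\<Sum>j<m. if j \<in> C then M $$ (j, l) / real (card C) else 0)"
    by (intro sum.cong) (auto simp: averaging_mat_entry[OF part C])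
  also have "\<dots> = (\<Sum>j\<in>{..<m} \<inter> C. M $$ (j, l) / real (card C))"
    by (simp add: sum.inter_restrict)
  also have "{..<m} \<inter> C = C" using P(2) C by auto
  finally show ?thesis by (simp add: sum_divide_distrib)
qed

text \<open>The entries of a column are already constant along each cluster, so averaging them again
  changes nothing.\<close>

lemma averaging_mat_idem:
  assumes part: "partition_on {..<m} \<C>"
  shows "averaging_mat m \<C> * averaging_mat m \<C> = averaging_mat m \<C>"
proof (rule eq_matI)
  fix i l assume "i < dim_row (averaging_mat m \<C>)" "l < dim_col (averaging_mat m \<C>)"
  then have il: "i < m" "l < m" by (simp_all add: averaging_mat_def)
  note P = partition_on_lessThan[OF part]
  obtain C where C: "C \<in> \<C>" "i \<in> C" using P(5) il by blast
  have "(averaging_mat m \<C> * averaging_mat m \<C>) $$ (i, l) =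
      (\<Sum>j\<in>C. averaging_mat m \<C> $$ (j, l)) / real (card C)"
    using il by (intro averaging_mat_mult[OF part C]) auto
  also have "\<dots> = (\<Sum>j\<in>C. averaging_mat m \<C> $$ (i, l)) / real (card C)"
    using C il by (simp add: averaging_mat_entry[OF part C(1)])
  also have "\<dots> = averaging_mat m \<C> $$ (i, l)"
    using P(4) C by simp
  finally show "(averaging_mat m \<C> * averaging_mat m \<C>) $$ (i, l) = averaging_mat m \<C> $$ (i, l)" .
qed (simp_all add: averaging_mat_def)

text \<open>A symmetric idempotent \<open>P\<close> satisfies
  \<open>P v \<bullet> P v = P v \<bullet> v\<close>; Cauchy-Schwarz and cancellation of one factor
  give the bound.\<close>

lemma averaging_mat_contraction:
  assumes part: "partition_on {..<m} \<C>" and v: "v \<in> carrier_vec m"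
  shows "vec_norm2 (averaging_mat m \<C> *\<^sub>v v) \<le> vec_norm2 v"
proof -
  let ?P = "averaging_mat m \<C>"
  have Pv: "?P *\<^sub>v v \<in> carrier_vec m" using v by (meson averaging_mat_carrier mult_mat_vec_carrier)
  have "(vec_norm2 (?P *\<^sub>v v))\<^sup>2 = (?P *\<^sub>v v) \<bullet> v"
    unfolding vec_norm2_square
    by (subst scalar_prod_mult_transpose[of _ m m])
       (use v in \<open>auto simp: averaging_mat_transpose averaging_mat_idem[OF part]\<close>)
  also have "\<dots> \<le> vec_norm2 (?P *\<^sub>v v) * vec_norm2 v"
    by (rule scalar_prod_le_vec_norm2[OF Pv v])
  finally show ?thesis
    by (cases "vec_norm2 (?P *\<^sub>v v) = 0")
       (auto simp: power2_eq_square less_le dest: mult_left_le_imp_le)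
qed

text \<open>Rows of the averaged matrix are the cluster means, so summing the squared rows cluster
  by cluster gives the cost. The variance thereby controls the action of \<open>Y - P Y\<close> on
  vectors.\<close>

lemma frobenius_sq_minus_averaging:
  assumes part: "partition_on {..<m} \<C>" and Y: "Y \<in> carrier_mat m k"
  shows "frobenius_sq (Y - averaging_mat m \<C> * Y) = clustering_cost Y \<C>"
proof -
  note P = partition_on_lessThan[OF part]
  let ?f = "\<lambda>j. \<Sum>l<k. ((Y - averaging_mat m \<C> * Y) $$ (j, l))\<^sup>2"
  have "(vec_norm2 (row Y j - cluster_mean Y C))\<^sup>2 = ?f j" if C: "C \<in> \<C>" "j \<in> C" for C j
  proof -
    have "j < m" using P(2) C by auto
    then show ?thesis
      unfolding vec_norm2_square using Y averaging_mat_mult[OF part C Y]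
      by (auto simp: scalar_prod_def cluster_mean_def power2_eq_square atLeast0LessThan averaging_mat_def
          simp del: index_mult_mat(1) intro!: sum.cong)
  qed
  then have "clustering_cost Y \<C> = (\<Sum>C\<in>\<C>. sum ?f C)"
    by (simp add: clustering_cost_def)
  also have "\<dots> = sum ?f (\<Union>\<C>)"
    by (rule sum.Union_disjoint[symmetric, unfolded comp_def]) (use P(3) P(6) in blast)+
  also have "\<Union>\<C> = {..<m}" using part by (simp add: partition_on_def)
  finally show ?thesis
    using Y by (simp add: frobenius_sq_def del: index_minus_mat(1))
qed

section \<open>The error of averaging over both partitions\<close>

lemma isometry_norm:
  assumes X: "X \<in> carrier_mat n k" and XX: "transpose_mat X * X = (1\<^sub>m k :: real mat)"
    and u: "u \<in> carrier_vec k"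
  shows "vec_norm2 (X *\<^sub>v u) = vec_norm2 u"
  unfolding vec_norm2_def using scalar_prod_mult_transpose[OF X u u] u by (simp add: XX)

text \<open>The residual contributes \<open>2 * c\<close>, once directly and once after averaging.
  The leading part contributes one error from averaging rows and one from averaging columns. The
  leading singular values enter only through the Frobenius norm of \<open>A\<close>.\<close>

lemma averaged_difference_norm_le:
  assumes A: "A \<in> carrier_mat m n" and lead: "leading_singular_vectors k A Y X"
    and U: "partition_on {..<m} \<U>" and V: "partition_on {..<n} \<V>"
    and res: "\<And>v. v \<in> carrier_vec n \<Longrightarrow>
        vec_norm2 ((A - A * X * transpose_mat X) *\<^sub>v v) \<le> c * vec_norm2 v"
    and c: "0 \<le> c" and v: "v \<in> carrier_vec n"
  shows "vec_norm2 ((A - averaging_mat m \<U> * (A * averaging_mat n \<V>)) *\<^sub>v v) \<le>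
    (2 * c + sqrt (frobenius_sq A) * (sqrt (clustering_cost Y \<U>) + sqrt (clustering_cost X \<V>))) * vec_norm2 v"
proof -
  let ?P = "averaging_mat m \<U>" and ?Q = "averaging_mat n \<V>"
  let ?z = "sqrt (frobenius_sq A)"
  define Z where "Z = diagonal_mat_of k (\<lambda>i. singular_values A ! i)"
  define T where "T = A * X * transpose_mat X"
  define R where "R = A - T"
  have Y: "Y \<in> carrier_mat m k" and X: "X \<in> carrier_mat n k"
    and YY: "transpose_mat Y * Y = 1\<^sub>m k" and XX: "transpose_mat X * X = 1\<^sub>m k"
    using lead A by (auto simp: leading_singular_vectors_def)
  have AX: "A * X = Y * Z" unfolding Z_def by (rule eigen_equations_of_leading[OF A lead])
  have Z: "Z \<in> carrier_mat k k" by (simp add: Z_def)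
  have P: "?P \<in> carrier_mat m m" and Q: "?Q \<in> carrier_mat n n" by simp_all
  have T: "T \<in> carrier_mat m n" using A X by (simp add: T_def)
  have R: "R \<in> carrier_mat m n" using T by (simp add: R_def minus_carrier_mat)
  have XT: "transpose_mat X \<in> carrier_mat k n" using X by simp
  define w where "w = ?Q *\<^sub>v v"
  have w: "w \<in> carrier_vec n" using mult_mat_vec_carrier[OF Q v] by (simp add: w_def)
  have wv: "vec_norm2 w \<le> vec_norm2 v"
    unfolding w_def by (rule averaging_mat_contraction[OF V v])
  have Az: "vec_norm2 (A *\<^sub>v u) \<le> ?z * vec_norm2 u" if "u \<in> carrier_vec n" for u
    using vec_norm2_mult_le_frobenius[of u A] A that by simp
  \<comment> \<open>Two readings of \<open>T\<close>: the form \<open>Y Z X\<^sup>T\<close> exposes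
    the row-representatives, and \<open>A X X\<^sup>T\<close> below is bounded by the Frobenius norm
    of \<open>A\<close>.\<close>
  have Tapp: "T *\<^sub>v u = Y *\<^sub>v (Z *\<^sub>v (transpose_mat X *\<^sub>v u))" if "u \<in> carrier_vec n" for u
    using X Y Z XT that unfolding T_def AX
    by (simp add: assoc_mult_mat_vec[of _ m k _ n] assoc_mult_mat_vec[of _ m k _ k])
  have Tapp2: "T *\<^sub>v u = A *\<^sub>v (X *\<^sub>v (transpose_mat X *\<^sub>v u))" if "u \<in> carrier_vec n" for u
  proof -
    have "transpose_mat X *\<^sub>v u \<in> carrier_vec k" using mult_mat_vec_carrier[OF XT that] .
    moreover have "A * X \<in> carrier_mat m k" using A X by simp
    ultimately show ?thesis
      unfolding T_def using assoc_mult_mat_vec[OF _ XT that] assoc_mult_mat_vec[OF A X] by metis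
  qed
  have Tnorm: "vec_norm2 (T *\<^sub>v u) \<le> ?z * vec_norm2 (transpose_mat X *\<^sub>v u)" if u: "u \<in> carrier_vec n" for u
    using Az[of "X *\<^sub>v (transpose_mat X *\<^sub>v u)"] isometry_norm[OF X XX, of "transpose_mat X *\<^sub>v u"] X u
    by (simp add: Tapp2[OF u])
  \<comment> \<open>Bessel's inequality for the orthonormal columns of \<open>X\<close>.\<close>
  have XTnorm: "vec_norm2 (transpose_mat X *\<^sub>v u) \<le> vec_norm2 u" if u: "u \<in> carrier_vec n" for u
  proof -
    let ?x = "transpose_mat X *\<^sub>v u"
    have x: "?x \<in> carrier_vec k" using mult_mat_vec_carrier[OF XT u] .
    have "(vec_norm2 ?x)\<^sup>2 = (X *\<^sub>v ?x) \<bullet> u"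
      unfolding vec_norm2_square
      using transpose_vec_mult_scalar[OF X x u] comm_scalar_prod[of u n "X *\<^sub>v ?x"] X u x by simp
    also have "\<dots> \<le> vec_norm2 ?x * vec_norm2 u"
      using scalar_prod_le_vec_norm2[of "X *\<^sub>v ?x" n u] isometry_norm[OF X XX x] X u by simp
    finally show ?thesis
      by (cases "vec_norm2 ?x = 0") (auto simp: power2_eq_square less_le dest: mult_left_le_imp_le)
  qed

  have t1: "vec_norm2 (R *\<^sub>v v) \<le> c * vec_norm2 v"
    using res[OF v] by (simp add: R_def T_def)
  have Rw: "R *\<^sub>v w \<in> carrier_vec m" using R w by simp
  have t2: "vec_norm2 (?P *\<^sub>v (R *\<^sub>v w)) \<le> c * vec_norm2 v"
  proof -
    have "vec_norm2 (?P *\<^sub>v (R *\<^sub>v w)) \<le> vec_norm2 (R *\<^sub>v w)"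
      by (rule averaging_mat_contraction[OF U Rw])
    also have "\<dots> \<le> c * vec_norm2 w" using res[OF w] by (simp add: R_def T_def)
    also have "\<dots> \<le> c * vec_norm2 v" using wv c by (rule mult_left_mono)
    finally show ?thesis .
  qed
  have t3: "vec_norm2 (T *\<^sub>v v - ?P *\<^sub>v (T *\<^sub>v v)) \<le> sqrt (clustering_cost Y \<U>) * (?z * vec_norm2 v)"
  proof -
    let ?x = "Z *\<^sub>v (transpose_mat X *\<^sub>v v)"
    have x: "?x \<in> carrier_vec k" using Z XT v by simp
    have PY: "?P * Y \<in> carrier_mat m k" by (rule mult_carrier_mat[OF P Y])
    have "T *\<^sub>v v - ?P *\<^sub>v (T *\<^sub>v v) = (Y - ?P * Y) *\<^sub>v ?x"
      unfolding Tapp[OF v] minus_mult_distrib_mat_vec[OF Y PY x] assoc_mult_mat_vec[OF P Y x] ..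
    then have "vec_norm2 (T *\<^sub>v v - ?P *\<^sub>v (T *\<^sub>v v)) \<le> sqrt (clustering_cost Y \<U>) * vec_norm2 ?x"
      using vec_norm2_mult_le_frobenius[of ?x "Y - ?P * Y"] x Y
      by (simp add: frobenius_sq_minus_averaging[OF U Y])
    moreover have "vec_norm2 ?x \<le> ?z * vec_norm2 v"
    proof -
      \<comment> \<open>Since \<open>Y\<close> is an isometry, the unbounded factor \<open>Z\<close>
        is absorbed into \<open>T v\<close>.\<close>
      have "vec_norm2 ?x = vec_norm2 (T *\<^sub>v v)"
        unfolding Tapp[OF v] by (rule isometry_norm[OF Y YY x, symmetric])
      also have "\<dots> \<le> ?z * vec_norm2 (transpose_mat X *\<^sub>v v)" by (rule Tnorm[OF v])
      also have "\<dots> \<le> ?z * vec_norm2 v"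
        using XTnorm[OF v] by (intro mult_left_mono) (auto simp: frobenius_sq_nonneg)
      finally show ?thesis .
    qed
    moreover have "0 \<le> clustering_cost Y \<U>"
      unfolding frobenius_sq_minus_averaging[OF U Y, symmetric] by (rule frobenius_sq_nonneg)
    ultimately show ?thesis
      by (meson mult_left_mono order_trans real_sqrt_ge_zero)
  qed
  have vw: "v - w \<in> carrier_vec n" using v w by (rule minus_carrier_vec)
  have Tvw: "T *\<^sub>v (v - w) \<in> carrier_vec m" using T vw by simp
  have t4: "vec_norm2 (?P *\<^sub>v (T *\<^sub>v (v - w))) \<le> ?z * (sqrt (clustering_cost X \<V>) * vec_norm2 v)"
  proof -
    have QX: "?Q * X \<in> carrier_mat n k" by (rule mult_carrier_mat[OF Q X])
    \<comment> \<open>The symmetry of the projection moves the averaging from the vector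
      \<open>v\<close> to the columns of \<open>X\<close>.\<close>
    have "transpose_mat X *\<^sub>v (v - w) = transpose_mat (X - ?Q * X) *\<^sub>v v"
    proof -
      have "transpose_mat (X - ?Q * X) = transpose_mat X - transpose_mat X * ?Q"
        using transpose_minus[OF X QX] transpose_mult[OF Q X] by (simp add: averaging_mat_transpose)
      then have "transpose_mat (X - ?Q * X) *\<^sub>v v = transpose_mat X *\<^sub>v v - (transpose_mat X * ?Q) *\<^sub>v v"
        using minus_mult_distrib_mat_vec[of "transpose_mat X" k n "transpose_mat X * ?Q" v] XT v by simp
      also have "(transpose_mat X * ?Q) *\<^sub>v v = transpose_mat X *\<^sub>v w"
        unfolding w_def by (rule assoc_mult_mat_vec[OF XT Q v])
      finally show ?thesis
        using mult_minus_distrib_mat_vec[OF XT v w] by simp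
    qed
    then have "vec_norm2 (transpose_mat X *\<^sub>v (v - w)) \<le> sqrt (clustering_cost X \<V>) * vec_norm2 v"
      using vec_norm2_mult_le_frobenius[of v "transpose_mat (X - ?Q * X)"] QX v
      by (simp add: frobenius_sq_transpose frobenius_sq_minus_averaging[OF V X])
    then have "?z * vec_norm2 (transpose_mat X *\<^sub>v (v - w)) \<le> ?z * (sqrt (clustering_cost X \<V>) * vec_norm2 v)"
      by (rule mult_left_mono) (simp add: frobenius_sq_nonneg)
    then show ?thesis
      using Tnorm[OF vw] averaging_mat_contraction[OF U Tvw] by linarith
  qed
  have split: "(A - ?P * (A * ?Q)) *\<^sub>v v =
      (R *\<^sub>v v - ?P *\<^sub>v (R *\<^sub>v w)) + ((T *\<^sub>v v - ?P *\<^sub>v (T *\<^sub>v v)) + ?P *\<^sub>v (T *\<^sub>v (v - w)))"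
  proof -
    have AQ: "A * ?Q \<in> carrier_mat m n" by (rule mult_carrier_mat[OF A Q])
    have "(?P * (A * ?Q)) *\<^sub>v v = ?P *\<^sub>v (A *\<^sub>v w)"
      unfolding w_def assoc_mult_mat_vec[OF P AQ v] assoc_mult_mat_vec[OF A Q v] ..
    then have 1: "(A - ?P * (A * ?Q)) *\<^sub>v v = A *\<^sub>v v - ?P *\<^sub>v (A *\<^sub>v w)"
      using minus_mult_distrib_mat_vec[of A m n "?P * (A * ?Q)" v] A AQ v P by simp
    have 2: "R *\<^sub>v u = A *\<^sub>v u - T *\<^sub>v u" if "u \<in> carrier_vec n" for u
      unfolding R_def by (rule minus_mult_distrib_mat_vec[OF A T that])
    have 3: "T *\<^sub>v (v - w) = T *\<^sub>v v - T *\<^sub>v w" by (rule mult_minus_distrib_mat_vec[OF T v w])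
    have c4: "A *\<^sub>v v \<in> carrier_vec m" "A *\<^sub>v w \<in> carrier_vec m" "T *\<^sub>v v \<in> carrier_vec m" "T *\<^sub>v w \<in> carrier_vec m"
      using A T v w by auto
    have c5: "?P *\<^sub>v (A *\<^sub>v w) \<in> carrier_vec m" "?P *\<^sub>v (T *\<^sub>v v) \<in> carrier_vec m" "?P *\<^sub>v (T *\<^sub>v w) \<in> carrier_vec m"
      using mult_mat_vec_carrier[OF P] c4 by blast+
    \<comment> \<open>The splitting as an identity in five vectors, used with
      \<open>x = A v\<close>, \<open>p = P A w\<close>, \<open>q = P T w\<close>,
      \<open>t = T v\<close> and \<open>y = P T v\<close>.\<close>
    have "x - p = (x - t - (p - q)) + ((t - y) + (y - q))"
      if "x \<in> carrier_vec m" "p \<in> carrier_vec m" "q \<in> carrier_vec m" "t \<in> carrier_vec m" "y \<in> carrier_vec m"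
      for x p q t y :: "real vec"
      using that by (intro eq_vecI) auto
    from this[OF c4(1) c5(1) c5(3) c4(3) c5(2)] show ?thesis
      unfolding 1 2[OF v] 2[OF w] 3 mult_minus_distrib_mat_vec[OF P c4(2,4)] mult_minus_distrib_mat_vec[OF P c4(3,4)] .
  qed
  have c6: "R *\<^sub>v v \<in> carrier_vec m" "T *\<^sub>v v \<in> carrier_vec m" using R T v by auto
  have c7: "?P *\<^sub>v (R *\<^sub>v w) \<in> carrier_vec m" "?P *\<^sub>v (T *\<^sub>v v) \<in> carrier_vec m" "?P *\<^sub>v (T *\<^sub>v (v - w)) \<in> carrier_vec m"
    using mult_mat_vec_carrier[OF P] c6 Rw Tvw by blast+
  have "vec_norm2 ((A - ?P * (A * ?Q)) *\<^sub>v v) \<le>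
      vec_norm2 (R *\<^sub>v v - ?P *\<^sub>v (R *\<^sub>v w)) +
      vec_norm2 ((T *\<^sub>v v - ?P *\<^sub>v (T *\<^sub>v v)) + ?P *\<^sub>v (T *\<^sub>v (v - w)))"
    unfolding split by (rule vec_norm2_triangle[of _ m]) (use c6 c7 in auto)
  also have "vec_norm2 (R *\<^sub>v v - ?P *\<^sub>v (R *\<^sub>v w)) \<le> vec_norm2 (R *\<^sub>v v) + vec_norm2 (?P *\<^sub>v (R *\<^sub>v w))"
    by (rule vec_norm2_triangle_minus[OF c6(1) c7(1)])
  also have "vec_norm2 ((T *\<^sub>v v - ?P *\<^sub>v (T *\<^sub>v v)) + ?P *\<^sub>v (T *\<^sub>v (v - w))) \<le>
      vec_norm2 (T *\<^sub>v v - ?P *\<^sub>v (T *\<^sub>v v)) + vec_norm2 (?P *\<^sub>v (T *\<^sub>v (v - w)))"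
    by (rule vec_norm2_triangle[of _ m]) (use c6 c7 in auto)
  finally show ?thesis using t1 t2 t3 t4 by (simp add: algebra_simps)
qed

section \<open>Reordering by clusters\<close>

text \<open>Concatenation lays the lists out in consecutive blocks. In the induction, every block
  after the first is shifted by the length of the first list.\<close>

lemma nth_image_block_of_concat:
  assumes "i < length xss"
  shows "(!) (concat xss) ` {sum_list (take i (map length xss)) ..< sum_list (take (Suc i) (map length xss))} = set (xss ! i)"
  using assms
proof (induction xss arbitrary: i)
  case (Cons xs xss)
  show ?case
  proof (cases i)
    case 0
    have "(!) (xs @ concat xss) ` {0..<length xs} = (!) xs ` {0..<length xs}"
      by (intro image_cong) (auto simp: nth_append)
    also have "\<dots> = set xs" by (auto simp: set_conv_nth)
    finally show ?thesis using 0 by simp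
  next
    case (Suc j)
    let ?a = "sum_list (take j (map length xss))" and ?b = "sum_list (take (Suc j) (map length xss))"
    have "(!) (concat (xs # xss)) ` {length xs + ?a ..< length xs + ?b} =
        (\<lambda>l. concat (xs # xss) ! (l + length xs)) ` {?a..<?b}"
    proof -
      have "{length xs + ?a ..< length xs + ?b} = (\<lambda>l. l + length xs) ` {?a..<?b}"
        by (subst image_add_atLeastLessThan') (simp add: add.commute)
      then show ?thesis by (simp only: image_image)
    qed
    also have "\<dots> = (!) (concat xss) ` {?a..<?b}"
      by (intro image_cong) (auto simp: nth_append)
    also have "\<dots> = set (xss ! j)"
      using Cons Suc by auto
    finally show ?thesis using Suc by simp
  qed
qed simp

text \<open>List the clusters in any order, list the elements of each, and read the permutation off
  the concatenation.\<close>

lemma orders_by_clusters_exists: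
  assumes part: "partition_on {..<m} \<C>"
  shows "\<exists>\<pi> ms. orders_by_clusters m \<C> \<pi> ms"
proof -
  note P = partition_on_lessThan[OF part]
  obtain Cs where Cs: "set Cs = \<C>" "distinct Cs"
    using finite_distinct_list[OF P(1)] by (elim exE conjE)
  define xss where "xss = map sorted_list_of_set Cs"
  define xs where "xs = concat xss"
  have set_nth: "set (xss ! i) = Cs ! i" if "i < length Cs" for i
    using that P(3)[of "Cs ! i"] Cs by (auto simp: xss_def)
  have set_xs: "set xs = {..<m}"
  proof -
    have "set xs = (\<Union>C\<in>set Cs. set (sorted_list_of_set C))" by (simp add: xs_def xss_def)
    also have "\<dots> = \<Union>\<C>" using P(3) Cs by simp
    finally show ?thesis using part by (simp add: partition_on_def)
  qed
  have "distinct xs"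
    unfolding xs_def
  proof (rule distinct_concat)
    have "inj_on sorted_list_of_set (set Cs)"
      using P(3) Cs by (intro inj_onI) (metis set_sorted_list_of_set)
    then show "distinct xss" using Cs by (simp add: xss_def distinct_map)
    show "distinct ys" if "ys \<in> set xss" for ys
      using that by (auto simp: xss_def)
    fix ys zs assume "ys \<in> set xss" "zs \<in> set xss" and neq: "ys \<noteq> zs"
    then obtain C D where CD: "C \<in> \<C>" "D \<in> \<C>" "ys = sorted_list_of_set C" "zs = sorted_list_of_set D"
      using Cs by (auto simp: xss_def)
    have sets: "set ys = C" "set zs = D" using CD P(3) by simp_all
    have "C \<noteq> D" using CD neq by auto
    then have "C \<inter> D = {}"
      using partition_onD2[OF part] CD(1,2) by (simp add: disjoint_def)
    then show "set ys \<inter> set zs = {}" by (simp only: sets)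
  qed
  then have len: "length xs = m"
    using distinct_card[of xs] by (simp add: set_xs)
  \<comment> \<open>Positions from \<open>m\<close> on are fixed, as \<open>permutes\<close>
    demands.\<close>
  define \<pi> where "\<pi> r = (if r < m then xs ! r else r)" for r
  have "bij_betw ((!) xs) {..<m} {..<m}"
    by (rule bij_betw_nth) (simp_all add: \<open>distinct xs\<close> len set_xs)
  then have "bij_betw \<pi> {..<m} {..<m}"
    by (subst bij_betw_cong[of _ _ "(!) xs"]) (auto simp: \<pi>_def)
  then have "\<pi> permutes {..<m}"
    by (rule bij_imp_permutes) (auto simp: \<pi>_def)
  moreover have "\<pi> ` block_range (map card Cs) i = Cs ! i" if i: "i < length Cs" for i
  proof -
    have lens: "map card Cs = map length xss"
      using P(3) Cs by (auto simp: xss_def)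
    \<comment> \<open>All blocks end at or before \<open>m\<close>, where \<open>\<pi>\<close>
      agrees with indexing into \<open>xs\<close>.\<close>
    have "sum_list (map length xss) = m"
      using len by (simp add: xs_def length_concat)
    moreover have "sum_list (map length xss) =
        sum_list (take (Suc i) (map length xss)) + sum_list (drop (Suc i) (map length xss))"
      by (simp only: sum_list_append[symmetric] append_take_drop_id)
    then have "sum_list (take (Suc i) (map length xss)) \<le> sum_list (map length xss)"
      by (metis le_add1)
    ultimately have "\<pi> ` block_range (map card Cs) i = (!) xs ` block_range (map card Cs) i"
      unfolding lens by (intro image_cong) (auto simp: block_range_def \<pi>_def)
    also have "\<dots> = set (xss ! i)"
      unfolding lens block_range_def xs_def
      by (rule nth_image_block_of_concat) (use i in \<open>simp add: xss_def\<close>)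
    finally show ?thesis using set_nth[OF i] by simp
  qed
  ultimately show ?thesis
    unfolding orders_by_clusters_def using Cs
    by (intro exI[of _ \<pi>] exI[of _ "map card Cs"] exI[of _ Cs] conjI) auto
qed

lemma sum_list_of_orders_by_clusters:
  assumes part: "partition_on {..<m} \<C>" and ord: "orders_by_clusters m \<C> \<pi> ms"
  shows "sum_list ms = m" "\<forall>s\<in>set ms. 0 < s"
proof -
  note P = partition_on_lessThan[OF part]
  obtain Cs where Cs: "distinct Cs" "set Cs = \<C>" "ms = map card Cs"
    using ord unfolding orders_by_clusters_def by blast
  have "sum_list ms = (\<Sum>C\<in>\<C>. card C)"
    using Cs by (simp add: sum_list_distinct_conv_sum_set)
  also have "\<dots> = card (\<Union>\<C>)"
    by (rule card_Union_disjoint[symmetric])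
       (use P(3) partition_onD2[OF part] in \<open>auto simp: disjoint_def pairwise_def disjnt_def\<close>)
  also have "\<Union>\<C> = {..<m}" using part by (simp add: partition_on_def)
  finally show "sum_list ms = m" by simp
  show "\<forall>s\<in>set ms. 0 < s" using Cs P(4) by auto
qed

text \<open>A pattern entry is the entry of \<open>M\<close> at arbitrary representatives of a row
  and a column cluster; constancy on products of clusters makes the choice immaterial. Nonnegativity
  carries over because pattern entries are entries of \<open>M\<close>.\<close>

lemma blown_up_matrix_reorder:
  assumes U: "partition_on {..<m} \<U>" and V: "partition_on {..<n} \<V>"
    and ordU: "orders_by_clusters m \<U> \<pi> ms" and ordV: "orders_by_clusters n \<V> \<sigma> ns"
    and M: "M \<in> carrier_mat m n"
    and const: "\<And>C D i i' j j'. C \<in> \<U> \<Longrightarrow> D \<in> \<V> \<Longrightarrow> i \<in> C \<Longrightarrow> i' \<in> C \<Longrightarrow> j \<in> D \<Longrightarrow> j' \<in> D \<Longrightarrow>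
      M $$ (i, j) = M $$ (i', j')"
  shows "\<exists>P. blown_up_matrix ms ns P (reorder_mat \<pi> \<sigma> M) \<and> (nonneg_entries M \<longrightarrow> nonneg_entries P)"
proof -
  obtain Cs where Cs: "set Cs = \<U>" "ms = map card Cs" "\<And>i. i < length Cs \<Longrightarrow> \<pi> ` block_range ms i = Cs ! i"
    using ordU unfolding orders_by_clusters_def by blast
  obtain Ds where Ds: "set Ds = \<V>" "ns = map card Ds" "\<And>i. i < length Ds \<Longrightarrow> \<sigma> ` block_range ns i = Ds ! i"
    using ordV unfolding orders_by_clusters_def by blast
  define P where "P = mat (length ms) (length ns) (\<lambda>(i, j). M $$ (SOME x. x \<in> Cs ! i, SOME y. y \<in> Ds ! j))"
  have C: "Cs ! i \<in> \<U>" "(SOME x. x \<in> Cs ! i) \<in> Cs ! i" if "i < length ms" for i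
  proof -
    show "Cs ! i \<in> \<U>" using that Cs by auto
    then have "0 < card (Cs ! i)" by (rule partition_on_lessThan(4)[OF U])
    then show "(SOME x. x \<in> Cs ! i) \<in> Cs ! i" by (auto simp: card_gt_0_iff some_in_eq)
  qed
  have D: "Ds ! i \<in> \<V>" "(SOME x. x \<in> Ds ! i) \<in> Ds ! i" if "i < length ns" for i
  proof -
    show "Ds ! i \<in> \<V>" using that Ds by auto
    then have "0 < card (Ds ! i)" by (rule partition_on_lessThan(4)[OF V])
    then show "(SOME x. x \<in> Ds ! i) \<in> Ds ! i" by (auto simp: card_gt_0_iff some_in_eq)
  qed
  have "reorder_mat \<pi> \<sigma> M $$ (r, s) = P $$ (i, j)"
    if i: "i < length ms" and j: "j < length ns" and r: "r \<in> block_range ms i" and s: "s \<in> block_range ns j" for i j r s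
  proof -
    have pi: "\<pi> r \<in> Cs ! i" and sg: "\<sigma> s \<in> Ds ! j"
      using imageI[OF r, of \<pi>] imageI[OF s, of \<sigma>] Cs(2,3) Ds(2,3) i j by auto
    then have "\<pi> r < m" "\<sigma> s < n"
      using C(1)[OF i] D(1)[OF j] partition_on_lessThan(2)[OF U] partition_on_lessThan(2)[OF V] by blast+
    then have "r < m" "s < n"
      using ordU ordV permutes_in_image[of \<pi> "{..<m}" r] permutes_in_image[of \<sigma> "{..<n}" s]
      by (auto simp: orders_by_clusters_def)
    then show ?thesis
      using M i j const[OF C(1)[OF i] D(1)[OF j] pi C(2)[OF i] sg D(2)[OF j]]
      by (simp add: reorder_mat_def P_def)
  qed
  moreover have "nonneg_entries P" if "nonneg_entries M"
  proof -
    have "(SOME x. x \<in> Cs ! i) < m" if "i < length ms" for i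
      using C[OF that] partition_on_lessThan(2)[OF U] by blast
    moreover have "(SOME x. x \<in> Ds ! i) < n" if "i < length ns" for i
      using D[OF that] partition_on_lessThan(2)[OF V] by blast
    ultimately show ?thesis
      using that M by (auto simp: nonneg_entries_def P_def)
  qed
  ultimately show ?thesis
    using sum_list_of_orders_by_clusters[OF U ordU] sum_list_of_orders_by_clusters[OF V ordV] M
    by (intro exI[of _ P]) (auto simp: blown_up_matrix_def P_def reorder_mat_def)
qed

section \<open>Norms under reordering, and block averages\<close>

lemma vec_norm2_permute:
  assumes "u \<in> carrier_vec m" "\<pi> permutes {..<m}"
  shows "vec_norm2 (vec m (\<lambda>i. u $ \<pi> i)) = vec_norm2 u"
proof -
  have "(\<Sum>i<m. u $ \<pi> i * u $ \<pi> i) = (\<Sum>i<m. u $ i * u $ i)"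
    using sum.permute[OF assms(2), of "\<lambda>i. u $ i * u $ i"] by (simp add: comp_def)
  then show ?thesis using assms by (simp add: vec_norm2_def scalar_prod_def atLeast0LessThan)
qed

text \<open>Reordering composes \<open>M\<close> with permutations of the coordinates on both sides,
  and these preserve the norm.\<close>

lemma reorder_mat_norm_le:
  assumes M: "M \<in> carrier_mat m n" and pi: "\<pi> permutes {..<m}" and sg: "\<sigma> permutes {..<n}"
    and le: "\<And>v. v \<in> carrier_vec n \<Longrightarrow> vec_norm2 (M *\<^sub>v v) \<le> c * vec_norm2 v"
    and v: "v \<in> carrier_vec n"
  shows "vec_norm2 (reorder_mat \<pi> \<sigma> M *\<^sub>v v) \<le> c * vec_norm2 v"
proof -
  \<comment> \<open>Chosen so that entry \<open>\<sigma> j\<close> of \<open>v'\<close> is entry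
    \<open>j\<close> of \<open>v\<close>.\<close>
  define v' where "v' = vec n (\<lambda>j. v $ inv_into UNIV \<sigma> j)"
  have v': "v' \<in> carrier_vec n" by (simp add: v'_def)
  have "reorder_mat \<pi> \<sigma> M *\<^sub>v v = vec m (\<lambda>i. (M *\<^sub>v v') $ \<pi> i)"
  proof (rule eq_vecI)
    fix i assume "i < dim_vec (vec m (\<lambda>i. (M *\<^sub>v v') $ \<pi> i))"
    then have i: "i < m" by simp
    then have pii: "\<pi> i < m" using permutes_in_image[OF pi] by auto
    have "(reorder_mat \<pi> \<sigma> M *\<^sub>v v) $ i = (\<Sum>j<n. M $$ (\<pi> i, \<sigma> j) * v $ j)"
      using M v i by (simp add: reorder_mat_def scalar_prod_def atLeast0LessThan)
    also have "\<dots> = (\<Sum>j<n. M $$ (\<pi> i, \<sigma> j) * v' $ \<sigma> j)"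
      using permutes_in_image[OF sg] permutes_inverses[OF sg] by (intro sum.cong) (auto simp: v'_def)
    also have "\<dots> = (\<Sum>j<n. M $$ (\<pi> i, j) * v' $ j)"
      using sum.permute[OF sg, of "\<lambda>j. M $$ (\<pi> i, j) * v' $ j"] by (simp add: comp_def)
    also have "\<dots> = (M *\<^sub>v v') $ \<pi> i"
      using M v' pii by (simp add: scalar_prod_def atLeast0LessThan)
    finally show "(reorder_mat \<pi> \<sigma> M *\<^sub>v v) $ i = vec m (\<lambda>i. (M *\<^sub>v v') $ \<pi> i) $ i"
      using i by simp
  qed (use M in \<open>simp add: reorder_mat_def\<close>)
  then have "vec_norm2 (reorder_mat \<pi> \<sigma> M *\<^sub>v v) = vec_norm2 (M *\<^sub>v v')"
    using vec_norm2_permute[OF _ pi] mult_mat_vec_carrier[OF M v'] by simp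
  also have "\<dots> \<le> c * vec_norm2 v'" by (rule le[OF v'])
  also have "vec_norm2 v' = vec_norm2 v"
    unfolding v'_def by (rule vec_norm2_permute[OF v permutes_inv[OF sg]])
  finally show ?thesis .
qed

lemma spectral_norm_bounds:
  assumes le: "\<And>v. v \<in> carrier_vec (dim_col M) \<Longrightarrow> vec_norm2 (M *\<^sub>v v) \<le> c * vec_norm2 v"
    and c: "0 \<le> c"
  shows "0 \<le> spectral_norm M" "spectral_norm M \<le> c"
proof -
  let ?S = "{vec_norm2 (M *\<^sub>v v) | v. v \<in> carrier_vec (dim_col M) \<and> vec_norm2 v \<le> 1}"
  have ub: "x \<le> c" if "x \<in> ?S" for x
  proof -
    obtain v where v: "v \<in> carrier_vec (dim_col M)" "vec_norm2 v \<le> 1" "x = vec_norm2 (M *\<^sub>v v)"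
      using \<open>x \<in> ?S\<close> by blast
    have "c * vec_norm2 v \<le> c" using v(2) c by (simp add: mult_left_le)
    then show ?thesis using le[OF v(1)] v(3) by simp
  qed
  \<comment> \<open>The zero vector makes the set nonempty, as the supremum requires, and yields the
    lower bound.\<close>
  have mem: "vec_norm2 (M *\<^sub>v 0\<^sub>v (dim_col M)) \<in> ?S"
    by (rule CollectI, rule exI[of _ "0\<^sub>v (dim_col M)"]) (simp add: vec_norm2_def)
  show "spectral_norm M \<le> c"
    unfolding spectral_norm_def using mem ub by (intro cSup_least) blast+
  have "vec_norm2 (M *\<^sub>v 0\<^sub>v (dim_col M)) \<le> spectral_norm M"
    unfolding spectral_norm_def using mem ub by (intro cSup_upper bdd_aboveI) blast+
  then show "0 \<le> spectral_norm M"
    using vec_norm2_nonneg order_trans by blast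
qed

text \<open>The right factor makes columns of one cluster equal, the left factor makes rows of one
  cluster equal.\<close>

lemma averaged_const_on_blocks:
  assumes U: "partition_on {..<m} \<U>" and V: "partition_on {..<n} \<V>" and A: "A \<in> carrier_mat m n"
    and C: "C \<in> \<U>" "i \<in> C" "i' \<in> C" and D: "D \<in> \<V>" "j \<in> D" "j' \<in> D"
  shows "(averaging_mat m \<U> * (A * averaging_mat n \<V>)) $$ (i, j) =
         (averaging_mat m \<U> * (A * averaging_mat n \<V>)) $$ (i', j')"
proof -
  have jn: "j < n" "j' < n" using partition_on_lessThan(2)[OF V] D by auto
  have AQ: "A * averaging_mat n \<V> \<in> carrier_mat m n" by (rule mult_carrier_mat[OF A]) simp
  have cols: "(A * averaging_mat n \<V>) $$ (x, j) = (A * averaging_mat n \<V>) $$ (x, j')" if "x < m" for x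
  proof -
    have "averaging_mat n \<V> $$ (y, j) = averaging_mat n \<V> $$ (y, j')" if "y < n" for y
    proof -
      obtain D' where D': "D' \<in> \<V>" "y \<in> D'" using partition_on_lessThan(5)[OF V \<open>y < n\<close>] by blast
      have "j \<in> D' \<longleftrightarrow> j' \<in> D'"
        using partition_on_lessThan(6)[OF V D(1) D'(1)] D by blast
      then show ?thesis
        by (simp add: averaging_mat_entry[OF V D'] jn)
    qed
    then show ?thesis
      using A \<open>x < m\<close> jn by (auto simp: scalar_prod_def averaging_mat_def intro!: sum.cong)
  qed
  show ?thesis
    unfolding averaging_mat_mult[OF U C(1,2) AQ jn(1)] averaging_mat_mult[OF U C(1,3) AQ jn(2)]
    using cols partition_on_lessThan(2)[OF U C(1)] by (intro arg_cong2[of _ _ _ _ "(/)"] sum.cong) auto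
qed

lemma nonneg_entries_mult:
  assumes "A \<in> carrier_mat m n" "B \<in> carrier_mat n p" "nonneg_entries A" "nonneg_entries B"
  shows "nonneg_entries (A * B)"
  using assms by (auto simp: nonneg_entries_def scalar_prod_def intro!: sum_nonneg)

lemma nonneg_entries_averaging_mat: "nonneg_entries (averaging_mat m \<C>)"
  using averaging_mat_nonneg by (auto simp: nonneg_entries_def averaging_mat_def intro!: sum_nonneg)

text \<open>The non-asymptotic half of the theorem. The norm bound is stated for every admissible
  \<open>c\<close>, so that the witnesses can be fixed for each matrix before any constant is
  known.\<close>

lemma blown_up_approximation:
  assumes A: "A \<in> carrier_mat m n"
    and U: "partition_on {..<m} \<U>" and V: "partition_on {..<n} \<V>"
  shows "\<exists>\<pi> \<sigma> ms ns P B E.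
    orders_by_clusters m \<U> \<pi> ms \<and> orders_by_clusters n \<V> \<sigma> ns \<and>
    blown_up_matrix ms ns P B \<and> (nonneg_entries A \<longrightarrow> nonneg_entries P) \<and>
    E \<in> carrier_mat m n \<and> reorder_mat \<pi> \<sigma> A = B + E \<and>
    (\<forall>c\<ge>0. (\<forall>v\<in>carrier_vec n.
        vec_norm2 ((A - averaging_mat m \<U> * (A * averaging_mat n \<V>)) *\<^sub>v v) \<le> c * vec_norm2 v) \<longrightarrow>
      \<bar>spectral_norm E\<bar> \<le> c)"
proof -
  define M where "M = averaging_mat m \<U> * (A * averaging_mat n \<V>)"
  have M: "M \<in> carrier_mat m n" unfolding M_def using A
    by (meson averaging_mat_carrier mult_carrier_mat)
  obtain \<pi> ms where ordU: "orders_by_clusters m \<U> \<pi> ms" using orders_by_clusters_exists[OF U] by blast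
  obtain \<sigma> ns where ordV: "orders_by_clusters n \<V> \<sigma> ns" using orders_by_clusters_exists[OF V] by blast
  have pi: "\<pi> permutes {..<m}" and sg: "\<sigma> permutes {..<n}"
    using ordU ordV by (auto simp: orders_by_clusters_def)
  have "\<exists>P. blown_up_matrix ms ns P (reorder_mat \<pi> \<sigma> M) \<and> (nonneg_entries M \<longrightarrow> nonneg_entries P)"
    by (rule blown_up_matrix_reorder[OF U V ordU ordV M])
       (unfold M_def, rule averaged_const_on_blocks[OF U V A])
  then obtain P where P: "blown_up_matrix ms ns P (reorder_mat \<pi> \<sigma> M)" "nonneg_entries M \<longrightarrow> nonneg_entries P"
    by blast
  \<comment> \<open>The error is the reordered deviation, so it inherits any bound for
    \<open>A - M\<close>.\<close>
  define E where "E = reorder_mat \<pi> \<sigma> (A - M)"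
  have E: "E \<in> carrier_mat m n" using M by (simp add: E_def reorder_mat_def)
  have "\<And>i. i < m \<Longrightarrow> \<pi> i < m" "\<And>i. i < n \<Longrightarrow> \<sigma> i < n"
    using permutes_in_image[OF pi] permutes_in_image[OF sg] by auto
  then have "reorder_mat \<pi> \<sigma> A = reorder_mat \<pi> \<sigma> M + E"
    using A M by (auto simp: E_def reorder_mat_def)
  moreover have "nonneg_entries P" if nn: "nonneg_entries A"
  proof -
    have "nonneg_entries (A * averaging_mat n \<V>)"
      by (rule nonneg_entries_mult[OF A averaging_mat_carrier nn nonneg_entries_averaging_mat])
    then have "nonneg_entries M"
      unfolding M_def
      by (rule nonneg_entries_mult[OF averaging_mat_carrier mult_carrier_mat[OF A averaging_mat_carrier]
            nonneg_entries_averaging_mat])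
    then show ?thesis using P(2) by simp
  qed
  moreover have "\<bar>spectral_norm E\<bar> \<le> c"
    if c: "0 \<le> c" and le: "\<And>v. v \<in> carrier_vec n \<Longrightarrow> vec_norm2 ((A - M) *\<^sub>v v) \<le> c * vec_norm2 v" for c
  proof -
    have "vec_norm2 (E *\<^sub>v v) \<le> c * vec_norm2 v" if "v \<in> carrier_vec (dim_col E)" for v
      unfolding E_def
      by (rule reorder_mat_norm_le[OF minus_carrier_mat[OF M] pi sg le])
         (use E that in auto)
    then show ?thesis using spectral_norm_bounds[of E c] c by simp
  qed
  ultimately show ?thesis
    unfolding M_def[symmetric]
    by (intro exI[of _ \<pi>] exI[of _ \<sigma>] exI[of _ ms] exI[of _ ns] exI[of _ P]
        exI[of _ "reorder_mat \<pi> \<sigma> M"] exI[of _ E] conjI allI impI ordU ordV P(1) E) simp_all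
qed

lemma frobenius_sq_le:
  assumes "A \<in> carrier_mat m n" "\<And>i j. i < m \<Longrightarrow> j < n \<Longrightarrow> \<bar>A $$ (i, j)\<bar> \<le> K"
  shows "frobenius_sq A \<le> K\<^sup>2 * (real m * real n)"
proof -
  have "(A $$ (i, j))\<^sup>2 \<le> K\<^sup>2" if "i < m" "j < n" for i j
    using power_mono[OF assms(2)[OF that], of 2] by simp
  then have "(\<Sum>i<m. \<Sum>j<n. (A $$ (i, j))\<^sup>2) \<le> (\<Sum>i<m. \<Sum>j<n. K\<^sup>2)"
    by (intro sum_mono) auto
  then show ?thesis using assms(1) by (simp add: frobenius_sq_def algebra_simps)
qed

text \<open>
  A position past the end of a list yields a value that depends only on its distance
  from the end, so divergence of the quotients rules out that the lists stay too short.
\<close>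
lemma eventually_less_length_if_nth_diverges:
  fixes f :: "'a \<Rightarrow> real list"
  assumes "filterlim (\<lambda>N. f N ! i / g N) at_top F" and "\<forall>\<^sub>F N in F. 1 \<le> (g N :: real)"
  shows "\<forall>\<^sub>F N in F. i < length (f N)"
proof -
  \<comment> \<open>Each \<open>[] ! j\<close> is some unspecified real. An overrun at position
    \<open>i\<close> has \<open>j\<close> at most \<open>i\<close>, so finitely many values occur;
    inserting zero makes \<open>b\<close> nonnegative.\<close>
  define b :: real where "b = Max (insert 0 ((\<lambda>j. [] ! j) ` {..i}))"
  have "\<forall>\<^sub>F N in F. b < f N ! i / g N"
    using assms(1) by (simp add: filterlim_at_top_dense)
  with assms(2) show ?thesis
  proof eventually_elim
    case (elim N)
    show ?case
    proof (rule ccontr)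
      assume "\<not> i < length (f N)"
      then have "f N ! i = [] ! (i - length (f N))"
        using nth_append_length_plus[of "f N" "[]" "i - length (f N)"] by simp
      then have "f N ! i \<le> b" unfolding b_def by (intro Max_ge) auto
      moreover have "0 \<le> b" unfolding b_def by (intro Max_ge) auto
      \<comment> \<open>As \<open>g N\<close> is at least 1 and \<open>b\<close> is nonnegative,
        division cannot raise the value above \<open>b\<close>.\<close>
      ultimately have "f N ! i / g N \<le> b"
        using elim by (simp add: divide_le_eq) (metis mult.right_neutral mult_left_mono order_trans)
      then show False using elim by simp
    qed
  qed
qed

section \<open>The approximation theorem\<close>

text \<open>Used with \<open>q = m n\<close> and \<open>p = m + n\<close>: the size
  \<open>m n\<close> in the Frobenius bound cancels the denominator of the variance bound, which
  leaves the order \<open>sqrt (m + n)\<close>.\<close>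

lemma sqrt_mult_sqrt_le:
  fixes s c p q :: real
  assumes "s \<le> c * (p / q)" "z \<le> K\<^sup>2 * q" "0 < q" "0 \<le> c" "0 \<le> z" "0 \<le> s" "0 \<le> p"
  shows "sqrt z * sqrt s \<le> \<bar>K\<bar> * sqrt c * sqrt p"
proof -
  have "sqrt z * sqrt s = sqrt (z * s)" by (simp add: real_sqrt_mult)
  also have "\<dots> \<le> sqrt ((K\<^sup>2 * q) * (c * (p / q)))"
    using assms by (intro real_sqrt_le_mono mult_mono) auto
  also have "(K\<^sup>2 * q) * (c * (p / q)) = K\<^sup>2 * c * p" using assms by simp
  finally show ?thesis by (simp add: real_sqrt_mult)
qed

text \<open>The guards on the dimensions reflect that \<open>k\<close> orthonormal vectors, or
  partitions into \<open>a\<close> and \<open>b\<close> nonempty parts, require enough rows and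
  columns. Since both dimensions tend to infinity, they hold eventually.\<close>

theorem theorem19:
  fixes m n :: "nat \<Rightarrow> nat"
    and A Y X :: "nat \<Rightarrow> real mat"
    and k a b :: nat
    and K :: real
    and \<U> \<V> :: "nat \<Rightarrow> nat set set"
  assumes "filterlim m at_top sequentially"
    and "filterlim n at_top sequentially"
    and "\<And>N. A N \<in> carrier_mat (m N) (n N)"
    and "\<And>N i j. i < m N \<Longrightarrow> j < n N \<Longrightarrow> \<bar>A N $$ (i, j)\<bar> \<le> K"
    and "\<And>i. i < k \<Longrightarrow>
           filterlim (\<lambda>N. singular_values (A N) ! i / sqrt (real (m N + n N))) at_top sequentially"
    and "\<exists>C. \<forall>\<^sub>F N in sequentially. \<forall>i. k \<le> i \<and> i < length (singular_values (A N)) \<longrightarrow>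
           singular_values (A N) ! i \<le> C * sqrt (real (m N + n N))"
    and "\<And>N. k \<le> m N \<Longrightarrow> k \<le> n N \<Longrightarrow> leading_singular_vectors k (A N) (Y N) (X N)"
    and "k \<le> a" and "k \<le> b"
    and "(\<lambda>N. cluster_variance a (Y N)) \<in> O(\<lambda>N. real (m N + n N) / (real (m N) * real (n N)))"
    and "(\<lambda>N. cluster_variance b (X N)) \<in> O(\<lambda>N. real (m N + n N) / (real (m N) * real (n N)))"
    and "\<And>N. a \<le> m N \<Longrightarrow> b \<le> n N \<Longrightarrow> minimizing_partition a (Y N) (\<U> N)"
    and "\<And>N. a \<le> m N \<Longrightarrow> b \<le> n N \<Longrightarrow> minimizing_partition b (X N) (\<V> N)"
  shows "\<exists>\<pi> \<sigma> ms ns P B E.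
           (\<forall>N. a \<le> m N \<longrightarrow> b \<le> n N \<longrightarrow>
              orders_by_clusters (m N) (\<U> N) (\<pi> N) (ms N) \<and>
              orders_by_clusters (n N) (\<V> N) (\<sigma> N) (ns N) \<and>
              blown_up_matrix (ms N) (ns N) (P N) (B N) \<and>
              (nonneg_entries (A N) \<longrightarrow> nonneg_entries (P N)) \<and>
              E N \<in> carrier_mat (m N) (n N) \<and>
              reorder_mat (\<pi> N) (\<sigma> N) (A N) = B N + E N) \<and>
           (\<lambda>N. spectral_norm (E N)) \<in> O(\<lambda>N. sqrt (real (m N + n N)))"
proof -
  note A = assms(3)
  have dims: "leading_singular_vectors k (A N) (Y N) (X N)"
      "Y N \<in> carrier_mat (m N) k" "X N \<in> carrier_mat (n N) k"
      "partition_on {..<m N} (\<U> N)" "partition_on {..<n N} (\<V> N)"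
      "clustering_cost (Y N) (\<U> N) = cluster_variance a (Y N)"
      "clustering_cost (X N) (\<V> N) = cluster_variance b (X N)"
    if "a \<le> m N" "b \<le> n N" for N
  proof -
    show lead: "leading_singular_vectors k (A N) (Y N) (X N)"
      using assms(7-9) that by simp
    then show "Y N \<in> carrier_mat (m N) k" "X N \<in> carrier_mat (n N) k"
      using A[of N] by (auto simp: leading_singular_vectors_def)
    then show "partition_on {..<m N} (\<U> N)" "partition_on {..<n N} (\<V> N)"
      "clustering_cost (Y N) (\<U> N) = cluster_variance a (Y N)"
      "clustering_cost (X N) (\<V> N) = cluster_variance b (X N)"
      using assms(12,13)[OF that] by (auto simp: minimizing_partition_def partitions_into_def)
  qed
  define dev where "dev N = A N - averaging_mat (m N) (\<U> N) * (A N * averaging_mat (n N) (\<V> N))" for N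
  define Q where "Q N \<pi> \<sigma> ms ns P B E \<longleftrightarrow>
      orders_by_clusters (m N) (\<U> N) \<pi> ms \<and> orders_by_clusters (n N) (\<V> N) \<sigma> ns \<and>
      blown_up_matrix ms ns P B \<and> (nonneg_entries (A N) \<longrightarrow> nonneg_entries P) \<and>
      E \<in> carrier_mat (m N) (n N) \<and> reorder_mat \<pi> \<sigma> (A N) = B + E \<and>
      (\<forall>c\<ge>0. (\<forall>v\<in>carrier_vec (n N). vec_norm2 (dev N *\<^sub>v v) \<le> c * vec_norm2 v) \<longrightarrow>
        \<bar>spectral_norm E\<bar> \<le> c)" for N \<pi> \<sigma> ms ns P B E
  have "\<exists>\<pi> \<sigma> ms ns P B E. Q N \<pi> \<sigma> ms ns P B E" if "a \<le> m N" "b \<le> n N" for N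
    unfolding Q_def dev_def by (rule blown_up_approximation[OF A dims(4,5)[OF that]])
  \<comment> \<open>Choice of one witness tuple for each \<open>N\<close>. Where the guards fail the
    values are arbitrary, which affects only finitely many terms of the order estimate.\<close>
  then obtain \<pi> \<sigma> ms ns P B E where Q: "\<And>N. a \<le> m N \<Longrightarrow> b \<le> n N \<Longrightarrow>
      Q N (\<pi> N) (\<sigma> N) (ms N) (ns N) (P N) (B N) (E N)"
    by metis
  obtain C0 where C0: "\<forall>\<^sub>F N in sequentially. \<forall>i. k \<le> i \<and> i < length (singular_values (A N)) \<longrightarrow>
           singular_values (A N) ! i \<le> C0 * sqrt (real (m N + n N))"
    using assms(6) by blast
  \<comment> \<open>The given constant may be negative, whereas \<open>residual_norm_le\<close> asks
    for a nonnegative bound.\<close>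
  define C where "C = max C0 0"
  obtain c1 where c1: "c1 > 0" "\<forall>\<^sub>F N in sequentially. norm (cluster_variance a (Y N)) \<le>
      c1 * norm (real (m N + n N) / (real (m N) * real (n N)))"
    using landau_o.bigE[OF assms(10)] by blast
  obtain c2 where c2: "c2 > 0" "\<forall>\<^sub>F N in sequentially. norm (cluster_variance b (X N)) \<le>
      c2 * norm (real (m N + n N) / (real (m N) * real (n N)))"
    using landau_o.bigE[OF assms(11)] by blast
  \<comment> \<open>The successors keep both dimensions positive even if \<open>a\<close> or
    \<open>b\<close> is zero, so that \<open>m n\<close> can be cancelled.\<close>
  have large: "\<forall>\<^sub>F N in sequentially. Suc a \<le> m N" "\<forall>\<^sub>F N in sequentially. Suc b \<le> n N"
    using assms(1,2) by (simp_all add: filterlim_at_top)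
  then have root: "\<forall>\<^sub>F N in sequentially. 1 \<le> sqrt (real (m N + n N))"
    by eventually_elim simp
  \<comment> \<open>Divergence of the leading quotients guarantees that the list eventually has
    \<open>k\<close> genuine entries, and below that these are nonnegative.\<close>
  have len: "\<forall>\<^sub>F N in sequentially. \<forall>i\<in>{..<k}. i < length (singular_values (A N))"
    by (intro eventually_ball_finite ballI)
       (use eventually_less_length_if_nth_diverges[OF assms(5) root] in auto)
  have "\<forall>\<^sub>F N in sequentially. 0 \<le> singular_values (A N) ! i" if "i < k" for i
  proof -
    have "\<forall>\<^sub>F N in sequentially. 0 \<le> singular_values (A N) ! i / sqrt (real (m N + n N))"
      using assms(5)[OF that] by (simp add: filterlim_at_top)
    with root show ?thesis by eventually_elim (auto simp: zero_le_divide_iff)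
  qed
  then have nonneg: "\<forall>\<^sub>F N in sequentially. \<forall>i\<in>{..<k}. 0 \<le> singular_values (A N) ! i"
    by (intro eventually_ball_finite ballI) auto
  \<comment> \<open>Twice the residual constant, plus the entry bound times the root of each
    variance constant.\<close>
  define c where "c = 2 * C + \<bar>K\<bar> * sqrt c1 + \<bar>K\<bar> * sqrt c2"
  have "\<forall>\<^sub>F N in sequentially. norm (spectral_norm (E N)) \<le> c * norm (sqrt (real (m N + n N)))"
    using C0 c1(2) c2(2) large len nonneg
  proof eventually_elim
    case (elim N)
    have ab: "a \<le> m N" "b \<le> n N" using elim by auto
    define s where "s = sqrt (real (m N + n N))"
    let ?z = "frobenius_sq (A N)" and ?u = "clustering_cost (Y N) (\<U> N)" and ?v = "clustering_cost (X N) (\<V> N)"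
    have u0: "0 \<le> ?u" "0 \<le> ?v"
      unfolding frobenius_sq_minus_averaging[OF dims(4)[OF ab] dims(2)[OF ab], symmetric]
        frobenius_sq_minus_averaging[OF dims(5)[OF ab] dims(3)[OF ab], symmetric]
      by (rule frobenius_sq_nonneg)+
    have z: "?z \<le> K\<^sup>2 * (real (m N) * real (n N))"
      by (rule frobenius_sq_le[OF A assms(4)])
    have mn: "0 < real (m N) * real (n N)" using elim by simp
    have "vec_norm2 ((A N - A N * X N * transpose_mat (X N)) *\<^sub>v v) \<le> (C * s) * vec_norm2 v"
      if "v \<in> carrier_vec (n N)" for v
    proof (rule residual_norm_le[OF A dims(1)[OF ab] _ _ _ _ that])
      show "k \<le> length (singular_values (A N))"
        using elim(6) by (metis lessThan_iff linorder_not_less order.refl)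
      fix i assume "k \<le> i" "i < length (singular_values (A N))"
      then have "singular_values (A N) ! i \<le> C0 * s" using elim(1) by (simp add: s_def)
      also have "\<dots> \<le> C * s" by (intro mult_right_mono) (auto simp: C_def s_def)
      finally show "singular_values (A N) ! i \<le> C * s" .
    qed (use elim in \<open>auto simp: C_def s_def\<close>)
    then have "vec_norm2 (dev N *\<^sub>v v) \<le> (2 * (C * s) + sqrt ?z * (sqrt ?u + sqrt ?v)) * vec_norm2 v"
      if "v \<in> carrier_vec (n N)" for v
      unfolding dev_def
      by (rule averaged_difference_norm_le[OF A dims(1)[OF ab] dims(4)[OF ab] dims(5)[OF ab] _ _ that])
         (auto simp: C_def s_def)
    moreover have "0 \<le> 2 * (C * s) + sqrt ?z * (sqrt ?u + sqrt ?v)"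
      using u0 by (simp add: C_def s_def frobenius_sq_nonneg)
    \<comment> \<open>Instantiates the universally quantified bound in \<open>Q\<close> with the
      estimate just obtained for \<open>dev N\<close>.\<close>
    ultimately have "\<bar>spectral_norm (E N)\<bar> \<le> 2 * (C * s) + sqrt ?z * (sqrt ?u + sqrt ?v)"
      using Q[OF ab] unfolding Q_def by blast
    also have "\<dots> \<le> c * s"
    proof -
      have "sqrt ?z * sqrt ?u \<le> \<bar>K\<bar> * sqrt c1 * s"
        unfolding s_def
        by (rule sqrt_mult_sqrt_le[OF _ z mn]) (use elim(2) u0 c1 dims(6)[OF ab] frobenius_sq_nonneg in auto)
      moreover have "sqrt ?z * sqrt ?v \<le> \<bar>K\<bar> * sqrt c2 * s"
        unfolding s_def
        by (rule sqrt_mult_sqrt_le[OF _ z mn]) (use elim(3) u0 c2 dims(7)[OF ab] frobenius_sq_nonneg in auto)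
      ultimately show ?thesis by (simp add: c_def algebra_simps)
    qed
    finally show ?case by (simp add: s_def)
  qed
  then have "(\<lambda>N. spectral_norm (E N)) \<in> O(\<lambda>N. sqrt (real (m N + n N)))"
    by (rule bigoI)
  with Q show ?thesis
    unfolding Q_def
    by (intro exI[of _ \<pi>] exI[of _ \<sigma>] exI[of _ ms] exI[of _ ns] exI[of _ P] exI[of _ B] exI[of _ E]) simp
qed

end
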